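(* Let $1 \le a < 2$ and let $U = \int_0^\infty e^{-2at}\, dS(t)$, where $S$ is the Lévy process with $S(0)=0$ and $E(e^{izS(t)}) = e^{t l(z)}$, $$l(z) = \sum_{k=-\infty}^{0} 2^{-k}\left(e^{iz2^k} - 1 - iz2^k\right) + \sum_{k=1}^{\infty} 2^{-k}\left(e^{iz2^k} - 1\right), \qquad z \in \mathbb{R}.$$ Then for every $x$ with $1 \le x < 2$, as $m \to \infty$ through the positive integers, $$2^m\, P\left(U > x 2^m + \frac{m}{2a}\right) \longrightarrow \frac{2\log 2 - \log x}{2a}.$$
   Context: $\log$ is the natural logarithm. The process $S$ can equivalently be written $S(t)=\sum_{k\in\mathbb{Z}} 2^k Z_k(t)$, where the $Z_k$ are independent, $Z_k$ is a Poisson process of rate $2^{-k}$ for $k\ge 1$, and $Z_k$ is a Poisson process of rate $2^{-k}$ minus its mean $2^{-k}t$ for $k \le 0$. *)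

theory Defs
  imports "HOL-Probability.Probability"
begin

text \<open>A real-valued Levy process indexed by the times \<open>t \<ge> 0\<close>; the values \<open>S t\<close> for
  \<open>t < 0\<close> are unconstrained. Stochastic continuity is not listed separately, since it follows from
  stationarity of the increments and right-continuity of the paths with left limits.\<close>

locale levy_process = prob_space M for M :: "'a measure" +
  fixes S :: "real \<Rightarrow> 'a \<Rightarrow> real"
  assumes measurable_process: "\<And>t. 0 \<le> t \<Longrightarrow> S t \<in> borel_measurable M"
    and start_zero: "AE \<omega> in M. S 0 \<omega> = 0"
    and indep_increments: "\<And>(n::nat) \<tau>. 0 \<le> \<tau> 0 \<Longrightarrow> (\<forall>i<n. \<tau> i < \<tau> (Suc i)) \<Longrightarrow>
          indep_vars (\<lambda>_. borel) (\<lambda>i \<omega>. S (\<tau> (Suc i)) \<omega> - S (\<tau> i) \<omega>) {..<n}"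
    and stationary_increments: "\<And>s t. 0 \<le> s \<Longrightarrow> 0 \<le> t \<Longrightarrow>
          distr M borel (\<lambda>\<omega>. S (s + t) \<omega> - S s \<omega>) = distr M borel (\<lambda>\<omega>. S t \<omega> - S 0 \<omega>)"
    and cadlag_paths: "AE \<omega> in M. \<forall>t\<ge>0. continuous (at_right t) (\<lambda>s. S s \<omega>) \<and>
          (0 < t \<longrightarrow> (\<exists>L. ((\<lambda>s. S s \<omega>) \<longlongrightarrow> L) (at_left t)))"

text \<open>Only meaningful when \<open>Y\<close> and (eventually along \<open>F\<close>) the \<open>X i\<close> are random variables, because
  \<open>measure\<close> is \<open>0\<close> on non-measurable sets.\<close>

definition tendsto_in_prob ::
    "'a measure \<Rightarrow> ('i \<Rightarrow> 'a \<Rightarrow> real) \<Rightarrow> ('a \<Rightarrow> real) \<Rightarrow> 'i filter \<Rightarrow> bool" where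
  "tendsto_in_prob M X Y F \<longleftrightarrow>
     (\<forall>\<epsilon>>0. ((\<lambda>i. \<P>(\<omega> in M. \<bar>X i \<omega> - Y \<omega>\<bar> > \<epsilon>)) \<longlongrightarrow> 0) F)"

text \<open>The pair \<open>(n, \<tau>)\<close> encodes the subdivision \<open>0 = \<tau> 0 < \<tau> 1 < \<dots> < \<tau> n = T\<close>; the filter expresses
  that the mesh tends to \<open>0\<close>.\<close>

definition fine_partitions :: "real \<Rightarrow> (nat \<times> (nat \<Rightarrow> real)) filter" where
  "fine_partitions T = (INF \<delta>\<in>{0<..}. principal {(n, \<tau>). \<tau> 0 = 0 \<and> \<tau> n = T \<and>
     (\<forall>i<n. \<tau> i < \<tau> (Suc i) \<and> \<tau> (Suc i) - \<tau> i < \<delta>)})"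

text \<open>The stochastic integral of a deterministic (continuous) integrand \<open>f\<close> over \<open>(0, T]\<close>, as the limit
  in probability of left-endpoint Riemann sums; it is determined up to almost sure equality.\<close>

definition has_stoch_integral ::
    "'a measure \<Rightarrow> (real \<Rightarrow> 'a \<Rightarrow> real) \<Rightarrow> (real \<Rightarrow> real) \<Rightarrow> real \<Rightarrow> ('a \<Rightarrow> real) \<Rightarrow> bool" where
  "has_stoch_integral M S f T J \<longleftrightarrow> J \<in> borel_measurable M \<and>
     tendsto_in_prob M (\<lambda>(n, \<tau>) \<omega>. \<Sum>i<n. f (\<tau> i) * (S (\<tau> (Suc i)) \<omega> - S (\<tau> i) \<omega>)) J
       (fine_partitions T)"

text \<open>The improper integral over \<open>(0, \<infinity>)\<close>: the limit in probability, as \<open>T\<close> tends to infinity, of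
  the integrals over \<open>(0, T]\<close>.\<close>

definition has_stoch_integral_infinity ::
    "'a measure \<Rightarrow> (real \<Rightarrow> 'a \<Rightarrow> real) \<Rightarrow> (real \<Rightarrow> real) \<Rightarrow> ('a \<Rightarrow> real) \<Rightarrow> bool" where
  "has_stoch_integral_infinity M S f U \<longleftrightarrow> U \<in> borel_measurable M \<and>
     (\<exists>J. (\<forall>T\<ge>0. has_stoch_integral M S f T (J T)) \<and> tendsto_in_prob M J U at_top)"

definition levy_exponent :: "real \<Rightarrow> complex" where
  "levy_exponent z =
     (\<Sum>\<^sub>\<infinity>k\<in>{..0::int}. 2 powi (- k) *
        (exp (\<i> * of_real z * 2 powi k) - 1 - \<i> * of_real z * 2 powi k)) +
     (\<Sum>\<^sub>\<infinity>k\<in>{1::int..}. 2 powi (- k) * (exp (\<i> * of_real z * 2 powi k) - 1))"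

end

theory Submission
  imports Defs
begin

text \<open>
  Put \<open>b = 2 * a\<close>. Approximating \<open>U\<close> by Riemann sums shows that its characteristic function is
  \<open>exp \<Phi>\<close> with \<open>\<Phi> z = \<integral>\<^sub>0\<^sup>\<infinity> l (z exp (- b t)) dt\<close>. The Levy measure of \<open>S\<close> is almost invariant under
  doubling, \<open>l (2 z) = 2 l z - 2 i z\<close>, hence \<open>\<Phi> (2 z) = 2 \<Phi> z - 2 i z / b\<close>, and
  \<open>W m = (U - m / b) / 2 ^ m\<close> has the characteristic function \<open>exp (\<Phi> z / 2 ^ m)\<close>. So \<open>W m\<close> is
  distributed like the Levy process with exponent \<open>\<Phi>\<close> at the time \<open>1 / 2 ^ m\<close>, and
  \<open>2 ^ m * P (W m > x)\<close> tends to the mass that the Levy measure of \<open>\<Phi>\<close> gives to \<open>(x, \<infinity>)\<close>, namely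
  \<open>\<Sum>k\<ge>1. 2 ^ (- k) * (k ln 2 - ln x) / b\<close>.
\<close>

section \<open>Small-time asymptotics from characteristic functions\<close>

text \<open>The obstacle: \<open>2 ^ m\<close> times the law of \<open>W m\<close> has total mass
  \<open>2 ^ m\<close>, which piles up at 0, where the Levy measure is infinite, so weak convergence
  does not apply to it. One operation on exponents repairs this: subtract from \<open>\<Phi>\<close>
  its average over a standard normal shift of the argument. A centred average reproduces affine
  functions, so the constant and the compensator drop out together, while the wave of frequency y
  keeps the factor \<open>gauss_weight y\<close>, of order \<open>y\<^sup>2\<close> at 0. What is
  left is the Fourier transform of a finite measure. The range of x fixes the final sum: for
  \<open>1 \<le> x < 2\<close>, a jump \<open>2 powi k\<close> discounted by
  \<open>exp (- b t)\<close> exceeds x at some positive time exactly when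
  \<open>k \<ge> 1\<close>.\<close>

lemma norm_exp_minus_one_le:
  fixes u :: complex
  assumes "Re u \<le> 0"
  shows "norm (exp u - 1) \<le> norm u"
proof -
  have "norm (exp u - exp 0) \<le> 1 * norm (u - 0)"
  proof (rule field_differentiable_bound)
    show "convex {u. Re u \<le> 0}"
      by (rule convex_halfspace_Re_le)
  qed (use assms in \<open>auto intro!: derivative_eq_intros\<close>)
  then show ?thesis by simp
qed

text \<open>This is the difference quotient of \<open>\<lambda>h. exp (u * h)\<close> at 0, taken
  along \<open>h = 1 / r m\<close>.\<close>

lemma tendsto_mult_exp_minus_one:
  fixes u :: complex
  assumes "filterlim r at_top sequentially"
  shows "(\<lambda>m. of_real (r m) * (exp (u / of_real (r m)) - 1)) \<longlonglongrightarrow> u"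
proof -
  have "((\<lambda>h. (exp (u * h) - 1) / h) \<longlongrightarrow> u) (at 0)"
  proof -
    have "((\<lambda>h. exp (u * h)) has_field_derivative u) (at 0)"
      by (auto intro!: derivative_eq_intros)
    then show ?thesis
      by (simp add: DERIV_def)
  qed
  moreover have "filterlim (\<lambda>m. of_real (inverse (r m)) :: complex) (at 0) sequentially"
  proof -
    have "(\<lambda>m. of_real (inverse (r m)) :: complex) \<longlonglongrightarrow> of_real 0"
      by (intro tendsto_of_real) (rule filterlim_compose[OF tendsto_inverse_0_at_top[OF filterlim_ident] assms])
    moreover have "eventually (\<lambda>m. of_real (inverse (r m)) \<noteq> (0::complex)) sequentially"
      using filterlim_at_top_dense[THEN iffD1, OF assms, rule_format, of 0]
      by (rule eventually_mono) simp
    ultimately show ?thesis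
      by (simp add: filterlim_at)
  qed
  ultimately have "(\<lambda>m. (exp (u * of_real (inverse (r m))) - 1) / of_real (inverse (r m))) \<longlonglongrightarrow> u"
    by (rule filterlim_compose)
  then show ?thesis
    by (simp add: field_simps)
qed

text \<open>
  For a standard normal \<open>N\<close>, the measure \<open>gauss_weight y p(dy)\<close> has the Fourier transform
  \<open>char p z - E (char p (z + N))\<close>. The weight vanishes at \<open>0\<close> to second order, which makes a Levy
  measure finite, and is bounded away from \<open>0\<close> on \<open>{x<..}\<close>, so that it can be divided out again.
\<close>

abbreviation gauss_weight :: "real \<Rightarrow> real" where
  "gauss_weight y \<equiv> 1 - exp (- y\<^sup>2 / 2)"

text \<open>The normal density is its own Fourier transform up to scaling; this is where the form of
  \<open>gauss_weight\<close> comes from.\<close>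

lemma integral_iexp_shift:
  "(CLINT s|std_normal_distribution. iexp ((z + s) * y)) = iexp (z * y) * of_real (exp (- y\<^sup>2 / 2))"
proof -
  have "(CLINT s|std_normal_distribution. iexp ((z + s) * y)) =
      (CLINT s|std_normal_distribution. iexp (z * y) * iexp (y * s))"
    by (intro Bochner_Integration.integral_cong) (auto simp: exp_add[symmetric] algebra_simps)
  also have "\<dots> = iexp (z * y) * char std_normal_distribution y"
    by (simp add: char_def)
  finally show ?thesis
    by (simp add: char_std_normal_distribution)
qed

lemma char_gauss_weight:
  assumes "real_distribution p"
  shows "(CLINT y|p. iexp (z * y) * of_real (gauss_weight y)) =
    char p z - (CLINT s|std_normal_distribution. char p (z + s))"
proof -
  interpret p: real_distribution p by fact
  interpret N: real_distribution std_normal_distribution by (rule real_dist_normal_dist)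
  interpret pair_prob_space std_normal_distribution p ..
  have "(CLINT s|std_normal_distribution. char p (z + s)) =
    (CLINT y|p. (CLINT s|std_normal_distribution. iexp ((z + s) * y)))"
    unfolding char_def
  proof (rule Fubini_integral[symmetric])
    show "integrable (std_normal_distribution \<Otimes>\<^sub>M p) (\<lambda>(s, y). iexp ((z + s) * y))"
      by (rule P.integrable_const_bound[where B=1]) (auto simp: split_beta)
  qed
  also have "\<dots> = (CLINT y|p. iexp (z * y) * of_real (exp (- y\<^sup>2 / 2)))"
    by (simp only: integral_iexp_shift)
  finally have *: "(CLINT s|std_normal_distribution. char p (z + s)) = \<dots>" .
  have "(CLINT y|p. iexp (z * y) * of_real (gauss_weight y)) =
    (CLINT y|p. iexp (z * y) - iexp (z * y) * of_real (exp (- y\<^sup>2 / 2)))"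
    by (simp add: algebra_simps)
  also have "\<dots> = char p z - (CLINT y|p. iexp (z * y) * of_real (exp (- y\<^sup>2 / 2)))"
    unfolding char_def
    by (rule Bochner_Integration.integral_diff;
        rule p.integrable_const_bound[where B=1]) (auto simp: norm_mult)
  finally show ?thesis
    using * by simp
qed

text \<open>Provides the dominating function: the exponents grow at most quadratically and the
  normal law has a second moment.\<close>

lemma integrable_std_normal_quadratic:
  "integrable std_normal_distribution (\<lambda>s. C * (1 + (z + s)\<^sup>2))"
proof -
  interpret N: real_distribution std_normal_distribution by (rule real_dist_normal_dist)
  have "integrable std_normal_distribution (\<lambda>s. C * (1 + z\<^sup>2) + (2 * C * z) * s ^ 1 + C * s ^ 2)"
    by (intro Bochner_Integration.integrable_add integrable_mult_right
        integrable_std_normal_distribution_moment) auto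
  then show ?thesis
    by (simp add: power2_sum algebra_simps)
qed

text \<open>
  The probability measures proportional to \<open>gauss_weight y (p m)(dy)\<close> converge weakly to \<open>Q\<close> by
  Levy's continuity theorem.
\<close>

lemma small_time_tail:
  fixes p :: "nat \<Rightarrow> real measure" and \<Phi> :: "real \<Rightarrow> complex" and x :: real
  assumes p: "\<And>m. real_distribution (p m)"
    and r_pos: "\<And>m. 0 < r m" and r_lim: "filterlim r at_top sequentially"
    and char_p: "\<And>m z. char (p m) z = exp (\<Phi> z / of_real (r m))"
    and meas [measurable]: "\<Phi> \<in> borel_measurable borel"
    and bound: "\<And>z. norm (\<Phi> z) \<le> C * (1 + z\<^sup>2)"
    and Q: "real_distribution Q" and "0 < c"
    and char_Q: "\<And>z. of_real c * char Q z = \<Phi> z - (CLINT s|std_normal_distribution. \<Phi> (z + s))"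
    and x: "0 < x" "measure Q {x} = 0"
  shows "(\<lambda>m. r m * measure (p m) {x<..}) \<longlonglongrightarrow> c * (\<integral>y. indicator {x<..} y / gauss_weight y \<partial>Q)"
proof -
  interpret N: real_distribution std_normal_distribution by (rule real_dist_normal_dist)
  interpret p: real_distribution "p m" for m by (rule p)
  interpret Q: real_distribution Q by (rule Q)
  \<comment> \<open>\<open>\<psi> m\<close> is the exponent of a compound Poisson law with intensity
    \<open>r m\<close> and jump law \<open>p m\<close>; it approximates
    \<open>\<Phi>\<close>.\<close>
  define \<psi> where "\<psi> m z = of_real (r m) * (char (p m) z - 1)" for m z
  define h where "h m z = of_real (r m) * (CLINT y|p m. iexp (z * y) * of_real (gauss_weight y))" for m z
  define g where "g m = (\<integral>y. gauss_weight y \<partial>p m)" for m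
  have weight_int: "integrable (p m) gauss_weight" for m
    by (rule p.integrable_const_bound[where B=1]) auto
  \<comment> \<open>Characteristic functions are bounded by 1, so the exponent has nonpositive real
    part. This makes the bound uniform in m, as dominated convergence under the normal average
    requires.\<close>
  have \<psi>_le: "norm (\<psi> m z) \<le> C * (1 + z\<^sup>2)" for m z
  proof -
    have "exp (Re (\<Phi> z / of_real (r m))) \<le> 1"
      using p.cmod_char_le_1[of m z] by (simp add: char_p)
    then have "norm (exp (\<Phi> z / of_real (r m)) - 1) \<le> norm (\<Phi> z / of_real (r m))"
      by (intro norm_exp_minus_one_le) simp
    then have "norm (\<psi> m z) \<le> norm (\<Phi> z)"
      using r_pos[of m] by (simp add: \<psi>_def char_p norm_mult norm_divide pos_le_divide_eq mult.commute)
    then show ?thesis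
      using bound[of z] by simp
  qed
  have \<psi>_meas [measurable]: "\<psi> m \<in> borel_measurable borel" for m
    unfolding \<psi>_def[abs_def] by measurable
  have \<psi>_lim: "(\<lambda>m. \<psi> m z) \<longlonglongrightarrow> \<Phi> z" for z
    unfolding \<psi>_def char_p by (rule tendsto_mult_exp_minus_one[OF r_lim])
  have h_eq: "h m z = \<psi> m z - (CLINT s|std_normal_distribution. \<psi> m (z + s))" for m z
  proof -
    have "integrable std_normal_distribution (\<lambda>s. char (p m) (z + s))"
      by (rule N.integrable_const_bound[where B=1]) (auto simp: p.cmod_char_le_1)
    moreover have "measure std_normal_distribution UNIV = 1"
      using N.prob_space by simp
    ultimately show ?thesis
      unfolding h_def \<psi>_def char_gauss_weight[OF p]
      by (simp add: algebra_simps)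
  qed
  have h_lim: "(\<lambda>m. h m z) \<longlonglongrightarrow> of_real c * char Q z" for z
    unfolding h_eq char_Q
    by (intro tendsto_diff \<psi>_lim
        integral_dominated_convergence[OF _ _ integrable_std_normal_quadratic[of C z]])
       (auto simp: \<psi>_lim \<psi>_le)
  have h_0: "h m 0 = of_real (r m * g m)" for m
  proof -
    have "(CLINT y|p m. iexp (0 * y) * of_real (gauss_weight y)) =
        (CLINT y|p m. of_real (gauss_weight y))"
      by simp
    also have "\<dots> = of_real (g m)"
      unfolding g_def by (rule integral_complex_of_real)
    finally show ?thesis
      by (simp add: h_def)
  qed
  have rg_lim: "(\<lambda>m. r m * g m) \<longlonglongrightarrow> c"
    using h_lim[of 0] unfolding h_0 by (simp add: Q.char_zero tendsto_of_real_iff del: of_real_mult)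
  then have "eventually (\<lambda>m. 0 < r m * g m) sequentially"
    using \<open>0 < c\<close> by (rule order_tendstoD)
  \<comment> \<open>Nothing so far keeps the normalising constant \<open>g m\<close> away from 0 for
    small m; the positive limit c does so from \<open>N0\<close> on, hence the shifted sequence
    below.\<close>
  then obtain N0 where N0: "\<And>m. m \<ge> N0 \<Longrightarrow> 0 < r m * g m"
    by (auto simp: eventually_sequentially)
  then have g_pos: "0 < g (m + N0)" for m
    using r_pos[of "m + N0"] by (metis le_add2 zero_less_mult_pos)
  define q where "q m = density (p (m + N0)) (\<lambda>y. gauss_weight y / g (m + N0))" for m
  have q_int: "(\<integral>y. f y \<partial>q m) = (\<integral>y. (gauss_weight y / g (m + N0)) *\<^sub>R f y \<partial>p (m + N0))"
    if [measurable]: "f \<in> borel_measurable borel" for f :: "real \<Rightarrow> 'b::{banach, second_countable_topology}" and m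
    unfolding q_def using g_pos[of m] by (intro integral_density) auto
  have q_real: "real_distribution (q m)" for m
  proof (rule real_distribution.intro)
    have "emeasure (q m) (space (q m)) = (\<integral>\<^sup>+y. ennreal (gauss_weight y / g (m + N0)) \<partial>p (m + N0))"
      unfolding q_def by (simp add: emeasure_density)
    also have "\<dots> = ennreal (\<integral>y. gauss_weight y / g (m + N0) \<partial>p (m + N0))"
      using g_pos[of m] weight_int by (intro nn_integral_eq_integral integrable_divide) auto
    also have "\<dots> = 1"
      using g_pos[of m] by (simp add: g_def)
    finally show "prob_space (q m)"
      by (rule prob_spaceI)
  qed (simp add: real_distribution_axioms_def q_def)
  have char_q: "char (q m) z = h (m + N0) z / of_real (r (m + N0) * g (m + N0))" for m z
  proof -
    have "char (q m) z =
        (CLINT y|p (m + N0). iexp (z * y) * of_real (gauss_weight y) / of_real (g (m + N0)))"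
      unfolding char_def by (subst q_int) (auto simp: scaleR_conv_of_real field_simps)
    then show ?thesis
      using r_pos[of "m + N0"] unfolding h_def by simp
  qed
  have "weak_conv_m q Q"
  proof (rule levy_continuity[OF q_real Q])
    fix z
    have "(\<lambda>m. h (m + N0) z / of_real (r (m + N0) * g (m + N0))) \<longlonglongrightarrow> of_real c * char Q z / of_real c"
      using \<open>0 < c\<close> h_lim rg_lim
      by (intro tendsto_divide tendsto_of_real LIMSEQ_ignore_initial_segment) auto
    then show "(\<lambda>m. char (q m) z) \<longlonglongrightarrow> char Q z"
      using \<open>0 < c\<close> by (simp add: char_q)
  qed
  \<comment> \<open>\<open>?f\<close> jumps only at x, which \<open>Q\<close> does not charge, and
    it is bounded by \<open>1 / gauss_weight x\<close> because the weight increases on the positive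
    axis.\<close>
  let ?f = "\<lambda>y. indicator {x<..} y / gauss_weight y"
  have "(\<lambda>m. \<integral>y. ?f y \<partial>q m) \<longlonglongrightarrow> (\<integral>y. ?f y \<partial>Q)"
  proof (rule weak_conv_imp_bdd_ae_continuous_conv[OF q_real Q \<open>weak_conv_m q Q\<close>])
    have "isCont ?f y" if "y \<noteq> x" for y
    proof (cases "y < x")
      case True
      have "eventually (\<lambda>y. 0 = ?f y) (nhds y)"
        using eventually_nhds_in_open[of "{..<x}" y] True
        by (auto elim!: eventually_mono)
      then show ?thesis
        using isCont_cong[of "\<lambda>_. 0" ?f y] by simp
    next
      case False
      have "eventually (\<lambda>y. 1 / gauss_weight y = ?f y) (nhds y)"
        using eventually_nhds_in_open[of "{x<..}" y] False that
        by (auto elim!: eventually_mono)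
      moreover have "isCont (\<lambda>y. 1 / gauss_weight y) y"
        using False that x by (intro continuous_intros) auto
      ultimately show ?thesis
        using isCont_cong[of "\<lambda>y. 1 / gauss_weight y" ?f y] by simp
    qed
    then have "{y. \<not> isCont ?f y} \<subseteq> {x}"
      by auto
    then have "emeasure Q {y. \<not> isCont ?f y} \<le> emeasure Q {x}"
      by (intro emeasure_mono) auto
    also have "\<dots> = 0"
      using x by (simp add: Q.emeasure_eq_measure)
    finally show "emeasure Q {y. \<not> isCont ?f y} = 0"
      by simp
    show "norm (?f y) \<le> 1 / gauss_weight x" for y
    proof (cases "x < y")
      case True
      then have "x\<^sup>2 \<le> y\<^sup>2"
        using x by (intro power_mono) auto
      then show ?thesis
        using True x by (auto intro!: divide_left_mono mult_pos_pos)
    qed auto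
    show "?f \<in> borel_measurable borel"
      by measurable
  qed
  moreover have "(\<lambda>m. r (m + N0) * g (m + N0)) \<longlonglongrightarrow> c"
    using rg_lim by (rule LIMSEQ_ignore_initial_segment)
  ultimately have "(\<lambda>m. r (m + N0) * g (m + N0) * (\<integral>y. ?f y \<partial>q m)) \<longlonglongrightarrow> c * (\<integral>y. ?f y \<partial>Q)"
    by (intro tendsto_mult)
  \<comment> \<open>On \<open>{x<..}\<close> the weight is nonzero and cancels its reciprocal, so
    that only the normalisation remains.\<close>
  moreover have "g (m + N0) * (\<integral>y. ?f y \<partial>q m) = measure (p (m + N0)) {x<..}" for m
  proof -
    have "(\<integral>y. ?f y \<partial>q m) = (\<integral>y. indicator {x<..} y / g (m + N0) \<partial>p (m + N0))"
      using x by (subst q_int, simp, intro Bochner_Integration.integral_cong) (auto split: split_indicator)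
    then show ?thesis
      using g_pos[of m] by simp
  qed
  ultimately have "(\<lambda>m. r (m + N0) * measure (p (m + N0)) {x<..}) \<longlonglongrightarrow> c * (\<integral>y. ?f y \<partial>Q)"
    by (simp add: mult.assoc)
  then show ?thesis
    by (rule LIMSEQ_offset)
qed

section \<open>The exponent of the driving process\<close>

text \<open>A compromise for the large jumps. The bound \<open>\<bar>u\<bar>\<close> at
  \<open>u = z * 2 ^ k\<close> is not summable against \<open>2 ^ (- k)\<close>, and the bound 2
  does not decay as z tends to 0, which the later integration over time needs. The square root gives
  both.\<close>

lemma norm_iexp_minus_one_le_sqrt: "norm (iexp u - 1) \<le> 2 * sqrt \<bar>u\<bar>"
proof (cases "\<bar>u\<bar> \<le> 1")
  case True
  have "norm (iexp u - 1) \<le> \<bar>u\<bar>"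
    using iexp_approx1[of u 0] by simp
  also have "\<dots> = sqrt \<bar>u\<bar> * sqrt \<bar>u\<bar>"
    by simp
  also have "\<dots> \<le> 2 * sqrt \<bar>u\<bar>"
    using True by (intro mult_right_mono) (auto intro: order_trans[of _ 1])
  finally show ?thesis .
next
  case False
  have "norm (iexp u - 1) \<le> norm (iexp u) + norm (1::complex)"
    by (rule norm_triangle_ineq4)
  also have "\<dots> \<le> 2 * sqrt \<bar>u\<bar>"
    using False by simp
  finally show ?thesis .
qed

text \<open>One formula for compensated and uncompensated jumps, so that shifting k is a reindexing
  of all integers.\<close>

definition levy_term :: "int \<Rightarrow> real \<Rightarrow> complex" where
  "levy_term k z = of_real (2 powi (- k)) *
     (iexp (z * 2 powi k) - 1 - \<i> * of_real (of_bool (k \<le> 0) * (z * 2 powi k)))"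

text \<open>Second-order Taylor expansion gives the rate \<open>1 / 2\<close> for the compensated
  terms, the square root bound the rate \<open>sqrt (1 / 2)\<close> for the others; the slower rate
  serves both.\<close>

lemma norm_levy_term_le:
  "norm (levy_term k z) \<le> 2 * (z\<^sup>2 + sqrt \<bar>z\<bar>) * sqrt (1 / 2) ^ nat \<bar>k\<bar>"
proof (cases "k \<le> 0")
  case True
  define n where "n = nat \<bar>k\<bar>"
  have k: "k = - int n"
    using True by (simp add: n_def)
  have "norm (levy_term k z) = 2 ^ n * norm (iexp (z / 2 ^ n) - 1 - \<i> * of_real (z / 2 ^ n))"
    using True by (simp add: levy_term_def k power_int_minus norm_mult norm_power divide_inverse)
  also have "\<dots> \<le> 2 ^ n * ((z / 2 ^ n)\<^sup>2 / 2)"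
    using iexp_approx1[of "z / 2 ^ n" 1] by (intro mult_left_mono) (auto simp: algebra_simps power2_eq_square)
  also have "\<dots> = z\<^sup>2 / 2 * (1 / 2) ^ n"
    by (simp add: power2_eq_square power_one_over field_simps)
  also have "\<dots> \<le> z\<^sup>2 / 2 * sqrt (1 / 2) ^ n"
    using real_le_rsqrt[of "1 / 2" "1 / 2"]
    by (intro mult_left_mono power_mono) (auto simp: power2_eq_square)
  also have "\<dots> \<le> 2 * (z\<^sup>2 + sqrt \<bar>z\<bar>) * sqrt (1 / 2) ^ n"
    by (intro mult_right_mono) auto
  finally show ?thesis
    by (simp add: n_def)
next
  case False
  define n where "n = nat \<bar>k\<bar>"
  have k: "k = int n"
    using False by (simp add: n_def)
  have "norm (levy_term k z) = (1 / 2) ^ n * norm (iexp (z * 2 ^ n) - 1)"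
    using False by (simp add: levy_term_def k power_int_minus norm_mult norm_power norm_inverse
        norm_divide power_one_over inverse_eq_divide)
  also have "\<dots> \<le> (1 / 2) ^ n * (2 * sqrt \<bar>z * 2 ^ n\<bar>)"
    by (intro mult_left_mono norm_iexp_minus_one_le_sqrt) auto
  also have "\<dots> = 2 * sqrt \<bar>z\<bar> * sqrt (1 / 2) ^ n"
  proof -
    have "(1 / 2 :: real) ^ n = sqrt (1 / 2) ^ n * sqrt (1 / 2) ^ n"
      by (simp flip: power_mult_distrib)
    moreover have "sqrt (1 / 2) ^ n * sqrt (2 ^ n) = 1"
      by (simp add: real_sqrt_divide real_sqrt_power power_one_over)
    moreover have "sqrt \<bar>z * 2 ^ n\<bar> = sqrt \<bar>z\<bar> * sqrt (2 ^ n)"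
      by (simp add: abs_mult real_sqrt_mult)
    ultimately show ?thesis
      by (metis (no_types, opaque_lifting) mult.assoc mult.commute mult.right_neutral)
  qed
  also have "\<dots> \<le> 2 * (z\<^sup>2 + sqrt \<bar>z\<bar>) * sqrt (1 / 2) ^ n"
    by (intro mult_right_mono) auto
  finally show ?thesis
    by (simp add: n_def)
qed

section \<open>Summation over all jump sizes\<close>

lemma abs_summable_on_int_geometric:
  assumes "0 \<le> q" "q < (1::real)"
  shows "Infinite_Set_Sum.abs_summable_on (\<lambda>k::int. q ^ nat \<bar>k\<bar>) UNIV"
proof -
  have 1: "Infinite_Set_Sum.abs_summable_on (\<lambda>n. q ^ n) (UNIV :: nat set)"
    using assms by (simp add: abs_summable_on_nat_iff' summable_geometric)
  have "bij_betw int UNIV {0..}"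
    by (rule bij_betwI[where g=nat]) auto
  from abs_summable_on_reindex_bij_betw[OF this, of "\<lambda>k. q ^ nat \<bar>k\<bar>"] 1
  have A: "Infinite_Set_Sum.abs_summable_on (\<lambda>k::int. q ^ nat \<bar>k\<bar>) {0..}"
    by simp
  have "bij_betw (\<lambda>n. - int n) UNIV {..0}"
    by (rule bij_betwI[where g="\<lambda>k. nat (- k)"]) auto
  from abs_summable_on_reindex_bij_betw[OF this, of "\<lambda>k. q ^ nat \<bar>k\<bar>"] 1
  have B: "Infinite_Set_Sum.abs_summable_on (\<lambda>k::int. q ^ nat \<bar>k\<bar>) {..0}"
    by simp
  have "{..0} \<union> {0..} = (UNIV :: int set)"
    by auto
  with abs_summable_on_union[OF B A] show ?thesis
    by simp
qed

lemma integrable_int_sqrt_half_power: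
  "integrable (count_space UNIV) (\<lambda>k::int. sqrt (1 / 2) ^ nat \<bar>k\<bar>)"
  using abs_summable_on_int_geometric[of "sqrt (1 / 2)"] by (simp add: abs_summable_on_def)

lemma integrable_levy_term: "integrable (count_space UNIV) (\<lambda>k. levy_term k z)"
  by (rule Bochner_Integration.integrable_bound[OF
        integrable_mult_right[OF integrable_int_sqrt_half_power, of "2 * (z\<^sup>2 + sqrt \<bar>z\<bar>)"]])
     (auto simp: abs_mult intro!: AE_I2 order_trans[OF norm_levy_term_le])

text \<open>Written as a Lebesgue integral for counting measure, the exponent becomes accessible to
  dominated convergence and Fubini.\<close>

lemma levy_exponent_eq_infsetsum: "levy_exponent z = (\<Sum>\<^sub>ak\<in>UNIV. levy_term k z)"
proof -
  have sum: "Infinite_Set_Sum.abs_summable_on (\<lambda>k. levy_term k z) A" for A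
    using integrable_levy_term abs_summable_on_subset[of "\<lambda>k. levy_term k z" UNIV A]
    by (auto simp: abs_summable_on_def)
  have "levy_exponent z = infsum (\<lambda>k. levy_term k z) {..0} + infsum (\<lambda>k. levy_term k z) {1..}"
    unfolding levy_exponent_def
    by (intro arg_cong2[where f="(+)"] infsum_cong)
       (auto simp: levy_term_def of_real_power_int algebra_simps)
  also have "\<dots> = infsetsum (\<lambda>k. levy_term k z) {..0} + infsetsum (\<lambda>k. levy_term k z) {1..}"
    by (simp add: infsetsum_infsum[OF sum])
  also have "\<dots> = infsetsum (\<lambda>k. levy_term k z) ({..0} \<union> {1..})"
    by (rule infsetsum_Un_disjoint[symmetric]) (auto intro: sum)
  also have "{..0} \<union> {1..} = (UNIV :: int set)"
    by auto
  finally show ?thesis .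
qed

text \<open>Doubling z moves every jump size to the next index and the intensities compensate by the
  factor 2. Only the size that passes from \<open>k = 0\<close> to \<open>k = 1\<close> changes its
  status from compensated to uncompensated, and its compensator is the drift term.\<close>

lemma levy_exponent_double: "levy_exponent (2 * z) = 2 * levy_exponent z - 2 * \<i> * of_real z"
proof -
  have sum: "Infinite_Set_Sum.abs_summable_on (\<lambda>k. levy_term k z) A" for A
    using integrable_levy_term abs_summable_on_subset[of "\<lambda>k. levy_term k z" UNIV A]
    by (auto simp: abs_summable_on_def)
  have bij: "bij_betw (\<lambda>k. k + 1) (UNIV :: int set) UNIV"
    by (rule bij_betwI[where g="\<lambda>k. k - 1"]) auto
  have sum': "Infinite_Set_Sum.abs_summable_on (\<lambda>k. levy_term (k + 1) z) UNIV"
    using abs_summable_on_reindex_bij_betw[OF bij, of "\<lambda>k. levy_term k z"] sum by simp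
  have sum0: "Infinite_Set_Sum.abs_summable_on (\<lambda>k. if k = 0 then 2 * \<i> * of_real z else 0) (UNIV :: int set)"
    by (rule abs_summable_on_cong_neutral[of "{0}", THEN iffD1, OF _ _ _ abs_summable_on_finite]) auto
  have "levy_term k (2 * z) = 2 * levy_term (k + 1) z - (if k = 0 then 2 * \<i> * of_real z else 0)" for k
  proof -
    have p: "2 powi (k + 1) = (2 powi k * 2 :: real)" "2 powi (- k) = (2 * 2 powi (- (k + 1)) :: real)"
      using power_int_add_1[of "2::real" k] power_int_add_1[of "2::real" "- k - 1"] by auto
    show ?thesis
    proof (cases "k = 0")
      case True
      then show ?thesis
        by (simp add: levy_term_def power_int_minus algebra_simps)
    next
      case False
      then have "(k + 1 \<le> 0) = (k \<le> 0)"
        by auto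
      then show ?thesis
        using False unfolding levy_term_def p by (simp add: mult_ac)
    qed
  qed
  then have "levy_exponent (2 * z) =
      (\<Sum>\<^sub>ak\<in>UNIV. 2 * levy_term (k + 1) z - (if k = 0 then 2 * \<i> * of_real z else 0))"
    by (simp add: levy_exponent_eq_infsetsum)
  also have "\<dots> = 2 * (\<Sum>\<^sub>ak\<in>UNIV. levy_term (k + 1) z)
      - (\<Sum>\<^sub>ak\<in>(UNIV::int set). if k = 0 then 2 * \<i> * of_real z else 0)"
    by (simp add: infsetsum_diff infsetsum_cmult_right abs_summable_on_cmult_right sum' sum0)
  also have "(\<Sum>\<^sub>ak\<in>UNIV. levy_term (k + 1) z) = levy_exponent z"
    using infsetsum_reindex_bij_betw[OF bij, of "\<lambda>k. levy_term k z"]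
    by (simp add: levy_exponent_eq_infsetsum)
  also have "(\<Sum>\<^sub>ak\<in>(UNIV::int set). if k = 0 then 2 * \<i> * of_real z else 0) =
      (\<Sum>\<^sub>ak\<in>{0::int}. if k = 0 then 2 * \<i> * of_real z else 0)"
    by (rule infsetsum_cong_neutral) auto
  finally show ?thesis
    by simp
qed

lemma isCont_levy_term: "isCont (levy_term k) z"
  unfolding levy_term_def[abs_def] by (intro continuous_intros)

text \<open>A convergent sequence of arguments is bounded by some \<open>K\<close>, which turns the
  termwise bound into one geometric majorant. Continuity is what the Riemann sums need
  later.\<close>

lemma isCont_levy_exponent: "isCont levy_exponent z"
  unfolding continuous_at_sequentially
proof safe
  fix u assume u: "u \<longlonglongrightarrow> z"
  obtain K where K: "\<And>n. norm (u n) \<le> K"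
    using convergent_imp_Bseq[OF convergentI[OF u]] by (auto simp: Bseq_def)
  have "0 \<le> K"
    using K[of 0] by (meson norm_ge_zero order_trans)
  show "(levy_exponent \<circ> u) \<longlonglongrightarrow> levy_exponent z"
    unfolding comp_def levy_exponent_eq_infsetsum infsetsum_def
  proof (rule integral_dominated_convergence)
    show "integrable (count_space UNIV) (\<lambda>k::int. 2 * (K\<^sup>2 + sqrt K) * sqrt (1 / 2) ^ nat \<bar>k\<bar>)"
      by (intro integrable_mult_right integrable_int_sqrt_half_power)
    show "AE k in count_space UNIV. (\<lambda>n. levy_term k (u n)) \<longlonglongrightarrow> levy_term k z"
      using isCont_tendsto_compose[OF isCont_levy_term u] by simp
    show "AE k in count_space UNIV. norm (levy_term k (u n)) \<le> 2 * (K\<^sup>2 + sqrt K) * sqrt (1 / 2) ^ nat \<bar>k\<bar>" for n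
    proof (rule AE_I2)
      fix k :: int
      have "2 * ((u n)\<^sup>2 + sqrt \<bar>u n\<bar>) * sqrt (1 / 2) ^ nat \<bar>k\<bar> \<le> 2 * (K\<^sup>2 + sqrt K) * sqrt (1 / 2) ^ nat \<bar>k\<bar>"
        using K[of n] \<open>0 \<le> K\<close> power_mono[of "\<bar>u n\<bar>" K 2]
        by (intro mult_right_mono mult_left_mono add_mono) auto
      then show "norm (levy_term k (u n)) \<le> 2 * (K\<^sup>2 + sqrt K) * sqrt (1 / 2) ^ nat \<bar>k\<bar>"
        using norm_levy_term_le by (rule order_trans[rotated])
    qed
  qed auto
qed

section \<open>The exponent and the Levy measure of the stochastic integral\<close>

lemma (in pair_sigma_finite) integrable_fst_times_snd:
  fixes f :: "'a \<Rightarrow> real" and g :: "'b \<Rightarrow> real"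
  assumes f: "integrable M1 f" and g: "integrable M2 g"
  shows "integrable (M1 \<Otimes>\<^sub>M M2) (\<lambda>(x, y). f x * g y)"
proof (rule Fubini_integrable)
  have [measurable]: "f \<in> borel_measurable M1" "g \<in> borel_measurable M2"
    using f g by auto
  show "(\<lambda>(x, y). f x * g y) \<in> borel_measurable (M1 \<Otimes>\<^sub>M M2)"
    by measurable
  have "integrable M1 (\<lambda>x. norm (f x) * (\<integral>y. norm (g y) \<partial>M2))"
    by (intro integrable_mult_left integrable_norm f)
  then show "integrable M1 (\<lambda>x. \<integral>y. norm (case (x, y) of (x, y) \<Rightarrow> f x * g y) \<partial>M2)"
    by (simp add: abs_mult)
  show "AE x in M1. integrable M2 (\<lambda>y. case (x, y) of (x, y) \<Rightarrow> f x * g y)"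
    using g by simp
qed

text \<open>
  A jump of \<open>S\<close> of size \<open>2 powi k\<close> at time \<open>t\<close> contributes \<open>ou_jump b (k, t)\<close> to \<open>U\<close>, so the Levy
  measure of \<open>U\<close> is the image under \<open>ou_jump b\<close> of the measure with density \<open>ou_weight\<close> on
  \<open>jump_space\<close>.
\<close>

abbreviation jump_space :: "(int \<times> real) measure" where
  "jump_space \<equiv> count_space UNIV \<Otimes>\<^sub>M lborel"

lemma pair_sigma_finite_jump_space: "pair_sigma_finite (count_space (UNIV :: int set)) (lborel :: real measure)"
  by (intro pair_sigma_finite.intro sigma_finite_measure_count_space_countable sigma_finite_lborel) auto

lemma integrable_exp_decay:
  assumes "0 < (c::real)"
  shows "integrable lborel (\<lambda>t. indicator {0<..} t * exp (- (c * t)))"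
proof -
  have "integrable lborel (\<lambda>t. exponential_density c t / c)"
  proof (intro integrable_divide integrableI_nonneg)
    interpret prob_space "density lborel (exponential_density c)"
      by (rule prob_space_exponential_density[OF assms])
    have "(\<integral>\<^sup>+t. ennreal (exponential_density c t) \<partial>lborel) = 1"
      using emeasure_space_1 by (simp add: emeasure_density)
    then show "(\<integral>\<^sup>+t. ennreal (exponential_density c t) \<partial>lborel) < \<infinity>"
      by simp
  qed (use assms in \<open>auto simp: exponential_density_def\<close>)
  then show ?thesis
    by (rule Bochner_Integration.integrable_bound)
       (use assms in \<open>auto simp: exponential_density_def mult.commute split: split_indicator\<close>)
qed

definition ou_jump :: "real \<Rightarrow> int \<times> real \<Rightarrow> real" where
  "ou_jump b = (\<lambda>(k, t). exp (- (b * t)) * 2 powi k)"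

definition ou_weight :: "int \<times> real \<Rightarrow> real" where
  "ou_weight = (\<lambda>(k, t). 2 powi (- k) * indicator {0<..} t)"

definition ou_integrand :: "real \<Rightarrow> real \<Rightarrow> int \<times> real \<Rightarrow> complex" where
  "ou_integrand b z = (\<lambda>(k, t). indicator {0<..} t *\<^sub>R levy_term k (z * exp (- (b * t))))"

text \<open>Integrating over sizes and times at once keeps the Levy measure visible; Fubini recovers
  the time integral of \<open>levy_exponent\<close>.\<close>

definition ou_exponent :: "real \<Rightarrow> real \<Rightarrow> complex" where
  "ou_exponent b z = (\<integral>\<omega>. ou_integrand b z \<omega> \<partial>jump_space)"

text \<open>The rate is \<open>b / 2\<close> rather than \<open>b\<close> because the bound for
  large jumps contains the square root of \<open>exp (- (b * t))\<close>.\<close>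

definition ou_bound :: "real \<Rightarrow> int \<times> real \<Rightarrow> real" where
  "ou_bound b = (\<lambda>(k, t). sqrt (1 / 2) ^ nat \<bar>k\<bar> * (indicator {0<..} t * exp (- (b / 2 * t))))"

text \<open>The Levy-Khintchine form: apart from the wave, the integrand is affine in z.\<close>

lemma ou_integrand_eq:
  "ou_integrand b z \<omega> = of_real (ou_weight \<omega>) *
    (iexp (z * ou_jump b \<omega>) - 1 - \<i> * of_real (of_bool (fst \<omega> \<le> 0) * (z * ou_jump b \<omega>)))"
  by (cases \<omega>) (simp add: ou_integrand_def levy_term_def ou_weight_def ou_jump_def scaleR_conv_of_real
      mult_ac split: split_indicator)

section \<open>Measurability and quadratic growth of the exponent\<close>

lemma measurable_ou_jump [measurable]: "ou_jump b \<in> borel_measurable jump_space"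
  unfolding ou_jump_def by (rule measurable_pair_measure_countable1) auto

lemma measurable_ou_weight [measurable]: "ou_weight \<in> borel_measurable jump_space"
  unfolding ou_weight_def by (rule measurable_pair_measure_countable1) auto

lemma measurable_of_bool_nonpos [measurable]:
  "(\<lambda>k::int. of_bool (k \<le> 0) :: real) \<in> borel_measurable (count_space UNIV)"
  by simp

lemma measurable_ou_integrand [measurable (raw)]:
  assumes [measurable]: "f \<in> borel_measurable N" "g \<in> measurable N jump_space"
  shows "(\<lambda>x. ou_integrand b (f x) (g x)) \<in> borel_measurable N"
proof -
  have [measurable]: "(\<lambda>x. of_bool (fst (g x) \<le> 0) :: real) \<in> borel_measurable N"
    by (rule measurable_compose[OF _ measurable_of_bool_nonpos]) measurable
  show ?thesis
    unfolding ou_integrand_eq by measurable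
qed

lemma integrable_ou_bound:
  assumes "0 < b"
  shows "integrable jump_space (ou_bound b)"
  unfolding ou_bound_def
  using assms by (intro pair_sigma_finite.integrable_fst_times_snd pair_sigma_finite_jump_space
      integrable_int_sqrt_half_power integrable_exp_decay) auto

lemma norm_ou_integrand_le:
  assumes "0 < b"
  shows "norm (ou_integrand b z \<omega>) \<le> 4 * (1 + z\<^sup>2) * ou_bound b \<omega>"
proof (cases \<omega>)
  case (Pair k t)
  show ?thesis
  proof (cases "0 < t")
    case True
    \<comment> \<open>With \<open>exp (- (b * t)) = e\<^sup>2\<close> the square root term decays
      like \<open>e\<close>, and the quadratic term, like \<open>e ^ 4\<close>, is smaller since
      \<open>e \<le> 1\<close>.\<close>
    define e where "e = exp (- (b / 2 * t))"
    have e: "0 < e" "e \<le> 1"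
      using assms True by (auto simp: e_def)
    have e2: "exp (- (b * t)) = e\<^sup>2" "exp (- (b * t / 2)) = e"
      by (simp_all add: e_def power2_eq_square flip: exp_add)
    have "sqrt \<bar>z\<bar> \<le> 1 + z\<^sup>2"
    proof -
      have "\<bar>z\<bar> \<le> 1 + z\<^sup>2"
        using sum_squares_bound[of 1 "\<bar>z\<bar>"] abs_ge_zero[of z] by simp
      also have "\<dots> \<le> (1 + z\<^sup>2)\<^sup>2"
        by (rule self_le_power) auto
      finally have "\<bar>z\<bar> \<le> (1 + z\<^sup>2)\<^sup>2" .
      then show ?thesis
        by (intro real_le_lsqrt) auto
    qed
    then have z: "z\<^sup>2 + sqrt \<bar>z\<bar> \<le> 2 * (1 + z\<^sup>2)"
      by simp
    have "(z * e\<^sup>2)\<^sup>2 + sqrt \<bar>z * e\<^sup>2\<bar> = z\<^sup>2 * e ^ 4 + sqrt \<bar>z\<bar> * e"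
      using e by (simp add: abs_mult real_sqrt_mult power_mult_distrib flip: power_mult)
    also have "\<dots> \<le> z\<^sup>2 * e + sqrt \<bar>z\<bar> * e"
      using e power_decreasing[of 1 4 e] by (intro add_mono mult_left_mono) auto
    also have "\<dots> = (z\<^sup>2 + sqrt \<bar>z\<bar>) * e"
      by (simp add: algebra_simps)
    also have "\<dots> \<le> 2 * (1 + z\<^sup>2) * e"
      using z e by (intro mult_right_mono) auto
    finally have "2 * ((z * e\<^sup>2)\<^sup>2 + sqrt \<bar>z * e\<^sup>2\<bar>) * sqrt (1 / 2) ^ nat \<bar>k\<bar>
        \<le> 2 * (2 * (1 + z\<^sup>2) * e) * sqrt (1 / 2) ^ nat \<bar>k\<bar>"
      by (intro mult_right_mono mult_left_mono) auto
    with norm_levy_term_le[of k "z * e\<^sup>2"] have "norm (levy_term k (z * e\<^sup>2)) \<le> 2 * (2 * (1 + z\<^sup>2) * e) * sqrt (1 / 2) ^ nat \<bar>k\<bar>"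
      by (rule order_trans)
    then show ?thesis
      using True by (simp add: Pair ou_integrand_def ou_bound_def e2 algebra_simps)
  qed (simp add: Pair ou_integrand_def ou_bound_def)
qed

lemma integrable_ou_integrand:
  assumes "0 < b"
  shows "integrable jump_space (ou_integrand b z)"
proof (rule Bochner_Integration.integrable_bound)
  show "integrable jump_space (\<lambda>\<omega>. 4 * (1 + z\<^sup>2) * ou_bound b \<omega>)"
    by (intro integrable_mult_right integrable_ou_bound assms)
  show "AE \<omega> in jump_space. norm (ou_integrand b z \<omega>) \<le> norm (4 * (1 + z\<^sup>2) * ou_bound b \<omega>)"
    unfolding real_norm_def
    by (intro AE_I2 order_trans[OF norm_ou_integrand_le[OF assms] abs_ge_self])
qed measurable

lemma norm_ou_exponent_le:
  assumes "0 < b"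
  shows "norm (ou_exponent b z) \<le> 4 * integral\<^sup>L jump_space (ou_bound b) * (1 + z\<^sup>2)"
proof -
  have "norm (ou_exponent b z) \<le> (\<integral>\<omega>. norm (ou_integrand b z \<omega>) \<partial>jump_space)"
    unfolding ou_exponent_def by (rule integral_norm_bound)
  also have "\<dots> \<le> (\<integral>\<omega>. 4 * (1 + z\<^sup>2) * ou_bound b \<omega> \<partial>jump_space)"
    by (intro integral_mono integrable_norm integrable_ou_integrand integrable_mult_right
        integrable_ou_bound norm_ou_integrand_le assms)
  also have "\<dots> = 4 * integral\<^sup>L jump_space (ou_bound b) * (1 + z\<^sup>2)"
    by (subst integral_mult_right_zero) (simp only: mult_ac)
  finally show ?thesis .
qed

lemma measurable_ou_exponent [measurable]: "ou_exponent b \<in> borel_measurable borel"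
proof -
  interpret pair_sigma_finite "count_space (UNIV :: int set)" "lborel :: real measure"
    by (rule pair_sigma_finite_jump_space)
  have "(\<lambda>z. \<integral>\<omega>. ou_integrand b z \<omega> \<partial>jump_space) \<in> borel_measurable borel"
    by (rule P.borel_measurable_lebesgue_integral) measurable
  then show ?thesis
    by (simp add: ou_exponent_def[abs_def])
qed

text \<open>The normal average has mean 0, so it returns the affine part of the integrand unchanged
  and only damps the wave; the difference is the wave times the weight. Finiteness of the weighted
  Levy measure follows because it arises as a difference of integrable functions.\<close>

lemma ou_exponent_gauss_difference:
  assumes "0 < b"
  shows "integrable jump_space (\<lambda>\<omega>. ou_weight \<omega> * gauss_weight (ou_jump b \<omega>))" (is ?int)
    and "ou_exponent b z - (CLINT s|std_normal_distribution. ou_exponent b (z + s)) =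
      (CLINT \<omega>|jump_space. of_real (ou_weight \<omega> * gauss_weight (ou_jump b \<omega>)) * iexp (z * ou_jump b \<omega>))"
proof -
  interpret N: real_distribution std_normal_distribution by (rule real_dist_normal_dist)
  interpret J: pair_sigma_finite "count_space (UNIV :: int set)" "lborel :: real measure"
    by (rule pair_sigma_finite_jump_space)
  interpret pair_sigma_finite std_normal_distribution jump_space ..
  have int: "integrable (std_normal_distribution \<Otimes>\<^sub>M jump_space) (\<lambda>(s, \<omega>). ou_integrand b (z + s) \<omega>)" for z
  proof (rule Bochner_Integration.integrable_bound)
    show "integrable (std_normal_distribution \<Otimes>\<^sub>M jump_space) (\<lambda>(s, \<omega>). 4 * (1 + (z + s)\<^sup>2) * ou_bound b \<omega>)"
      by (intro integrable_fst_times_snd integrable_std_normal_quadratic integrable_ou_bound assms)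
    show "AE p in std_normal_distribution \<Otimes>\<^sub>M jump_space.
        norm (case p of (s, \<omega>) \<Rightarrow> ou_integrand b (z + s) \<omega>)
        \<le> norm (case p of (s, \<omega>) \<Rightarrow> 4 * (1 + (z + s)\<^sup>2) * ou_bound b \<omega>)"
      unfolding split_beta real_norm_def
      by (intro AE_I2 order_trans[OF norm_ou_integrand_le[OF assms] abs_ge_self])
  qed measurable
  have inner: "ou_integrand b z \<omega> - (CLINT s|std_normal_distribution. ou_integrand b (z + s) \<omega>) =
      of_real (ou_weight \<omega> * gauss_weight (ou_jump b \<omega>)) * iexp (z * ou_jump b \<omega>)" for z \<omega>
  proof -
    have [simp]: "measure std_normal_distribution UNIV = 1"
      using N.prob_space by simp
    have i1: "integrable std_normal_distribution (\<lambda>s. s)"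
      using integrable_std_normal_distribution_moment[of 1] by simp
    have i2: "(\<integral>s. s \<partial>std_normal_distribution) = 0"
      using integral_std_normal_distribution_moment_odd[of 1] by simp
    have i3: "integrable std_normal_distribution (\<lambda>s. iexp ((z + s) * ou_jump b \<omega>))"
      by (rule N.integrable_const_bound[where B=1]) auto
    have i4: "integrable std_normal_distribution (\<lambda>s. of_real (of_bool (fst \<omega> \<le> 0) * ((z + s) * ou_jump b \<omega>)) :: complex)"
      using i1 by (intro integrable_of_real integrable_mult_right integrable_mult_left
          Bochner_Integration.integrable_add) auto
    have i5: "(CLINT s|std_normal_distribution. of_real (of_bool (fst \<omega> \<le> 0) * ((z + s) * ou_jump b \<omega>))) =
        of_real (of_bool (fst \<omega> \<le> 0) * (z * ou_jump b \<omega>))"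
      unfolding integral_complex_of_real using i1 i2 by simp
    have "(CLINT s|std_normal_distribution. ou_integrand b (z + s) \<omega>) =
        of_real (ou_weight \<omega>) * (iexp (z * ou_jump b \<omega>) * of_real (exp (- (ou_jump b \<omega>)\<^sup>2 / 2)) - 1
          - \<i> * of_real (of_bool (fst \<omega> \<le> 0) * (z * ou_jump b \<omega>)))"
      unfolding ou_integrand_eq integral_iexp_shift[symmetric] i5[symmetric]
      using i3 i4 by (simp del: of_real_mult)
    then show ?thesis
      unfolding ou_integrand_eq by (simp add: algebra_simps)
  qed
  have cint: "integrable jump_space (\<lambda>\<omega>. of_real (ou_weight \<omega> * gauss_weight (ou_jump b \<omega>)) * iexp (z * ou_jump b \<omega>))" for z
    unfolding inner[symmetric]
    using integrable_snd[OF int] by (intro Bochner_Integration.integrable_diff integrable_ou_integrand assms) simp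
  \<comment> \<open>At frequency 0 the wave equals 1.\<close>
  show ?int
    using integrable_Re[OF cint[of 0]] by simp
  have "(CLINT s|std_normal_distribution. ou_exponent b (z + s)) =
      (CLINT \<omega>|jump_space. (CLINT s|std_normal_distribution. ou_integrand b (z + s) \<omega>))"
    unfolding ou_exponent_def by (rule Fubini_integral[symmetric]) (rule int)
  then have "ou_exponent b z - (CLINT s|std_normal_distribution. ou_exponent b (z + s)) =
      (CLINT \<omega>|jump_space. ou_integrand b z \<omega> - (CLINT s|std_normal_distribution. ou_integrand b (z + s) \<omega>))"
    unfolding ou_exponent_def[of b z]
    using integrable_snd[OF int] by (subst Bochner_Integration.integral_diff) (auto intro: integrable_ou_integrand assms)
  then show "ou_exponent b z - (CLINT s|std_normal_distribution. ou_exponent b (z + s)) =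
      (CLINT \<omega>|jump_space. of_real (ou_weight \<omega> * gauss_weight (ou_jump b \<omega>)) * iexp (z * ou_jump b \<omega>))"
    unfolding inner .
qed

section \<open>Mass of the Levy measure above a level\<close>

lemma AE_ou_jump_neq:
  assumes "0 < b" "0 < x"
  shows "AE \<omega> in jump_space. ou_jump b \<omega> \<noteq> x"
proof (rule pair_sigma_finite.AE_pair_measure[OF pair_sigma_finite_jump_space])
  show "{\<omega> \<in> space jump_space. ou_jump b \<omega> \<noteq> x} \<in> sets jump_space"
    by measurable
  show "AE k in count_space UNIV. AE t in lborel. ou_jump b (k, t) \<noteq> x"
  proof (rule AE_I2)
    fix k :: int
    \<comment> \<open>For fixed k the jump size is strictly decreasing in t, so it meets the level x
      at one time at most.\<close>
    have "{t. ou_jump b (k, t) = x} \<subseteq> {- ln (x / 2 powi k) / b}"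
    proof
      fix t assume "t \<in> {t. ou_jump b (k, t) = x}"
      then have "x / 2 powi k = exp (- (b * t))"
        by (auto simp: ou_jump_def)
      then show "t \<in> {- ln (x / 2 powi k) / b}"
        using assms by simp
    qed
    then have "countable {t. ou_jump b (k, t) = x}"
      by (rule countable_subset) simp
    then have "emeasure lborel {t. ou_jump b (k, t) = x} = 0"
      by (rule emeasure_lborel_countable)
    then show "AE t in lborel. ou_jump b (k, t) \<noteq> x"
      by (intro AE_I'[of "{t. ou_jump b (k, t) = x}"] null_setsI)
         (auto simp: ou_jump_def)
  qed
qed

text \<open>Combines the sums of \<open>n / 2 ^ n\<close>, which is 2, and of
  \<open>1 / 2 ^ n\<close>, which is 1, over \<open>n \<ge> 1\<close>. With
  \<open>c = ln 2 / b\<close> and \<open>d = ln x / b\<close> it yields the constant of the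
  theorem.\<close>

lemma sums_half_power_tail:
  "(\<lambda>n. (1 / 2) ^ Suc n * (real (Suc n) * c - d)) sums (2 * c - d)"
proof -
  have "(\<lambda>n. of_nat (Suc n) * (1 / 2) ^ n :: real) sums (1 / (1 - 1 / 2)\<^sup>2)"
    by (rule geometric_deriv_sums) auto
  from sums_mult[OF this, of "c / 2"]
  have "(\<lambda>n. (1 / 2) ^ Suc n * (real (Suc n) * c)) sums (2 * c)"
    by (simp add: power2_eq_square field_simps)
  moreover have "(\<lambda>n. (1 / 2) ^ Suc n * d) sums d"
    using sums_mult2[OF power_half_series, of d] by simp
  ultimately show ?thesis
    unfolding right_diff_distrib by (rule sums_diff)
qed

lemma ou_levy_measure_tail:
  assumes b: "0 < b" and x: "1 \<le> x" "x < 2"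
  shows "(\<integral>\<omega>. ou_weight \<omega> * indicator {x<..} (ou_jump b \<omega>) \<partial>jump_space) = (2 * ln 2 - ln x) / b"
    and "integrable jump_space (\<lambda>\<omega>. ou_weight \<omega> * indicator {x<..} (ou_jump b \<omega>))"
proof -
  interpret pair_sigma_finite "count_space (UNIV :: int set)" "lborel :: real measure"
    by (rule pair_sigma_finite_jump_space)
  \<comment> \<open>\<open>T k\<close> is the time until which the discounted jump of initial size
    \<open>2 powi k\<close> stays above x.\<close>
  define T where "T k = (of_int k * ln 2 - ln x) / b" for k
  have gt_iff: "x < ou_jump b (k, t) \<longleftrightarrow> t < T k" for k t
  proof -
    have "x < ou_jump b (k, t) \<longleftrightarrow> ln x < ln (exp (- (b * t)) * 2 powi k)"
      using x by (simp add: ou_jump_def)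
    also have "\<dots> \<longleftrightarrow> ln x < - (b * t) + of_int k * ln 2"
      by (simp add: ln_mult ln_powr flip: powr_real_of_int')
    also have "\<dots> \<longleftrightarrow> t < T k"
      using b by (auto simp: T_def field_simps)
    finally show ?thesis .
  qed
  \<comment> \<open>\<open>1 \<le> x\<close> rules out the jumps with \<open>k \<le> 0\<close>,
    while \<open>x < 2\<close> makes \<open>T k\<close> nonnegative for every
    \<open>k \<ge> 1\<close>, so the sum contains \<open>T k\<close> itself and not its positive
    part.\<close>
  have T_nonpos: "T k \<le> 0" if "k \<le> 0" for k
  proof -
    have "of_int k * ln 2 \<le> (0::real)"
      using that by (intro mult_nonpos_nonneg) auto
    then have "of_int k * ln 2 - ln x \<le> 0"
      using ln_ge_zero[OF x(1)] by linarith
    then show ?thesis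
      using b by (simp add: T_def divide_nonpos_pos)
  qed
  have T_nonneg: "0 \<le> T k" if "1 \<le> k" for k
  proof -
    have "ln x \<le> ln 2"
      using x by simp
    also have "\<dots> \<le> of_int k * ln (2::real)"
      using that by simp
    finally show ?thesis
      using b by (simp add: T_def)
  qed
  have inner: "ou_weight (k, t) * indicator {x<..} (ou_jump b (k, t)) =
      2 powi (- k) * indicator {0<..<T k} t" for k t
    using gt_iff[of k t] by (auto simp: ou_weight_def split: split_indicator)
  have inner_int: "(\<integral>t. ou_weight (k, t) * indicator {x<..} (ou_jump b (k, t)) \<partial>lborel) =
      (if 1 \<le> k then 2 powi (- k) * T k else 0)" for k
    unfolding inner using T_nonpos[of k] T_nonneg[of k] by auto
  \<comment> \<open>Above the level x the quotient of the weights is at least 1, so the finite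
    weighted measure dominates.\<close>
  show int: "integrable jump_space (\<lambda>\<omega>. ou_weight \<omega> * indicator {x<..} (ou_jump b \<omega>))"
  proof (rule Bochner_Integration.integrable_bound)
    show "integrable jump_space (\<lambda>\<omega>. ou_weight \<omega> * gauss_weight (ou_jump b \<omega>) / gauss_weight x)"
      by (intro integrable_divide ou_exponent_gauss_difference b)
    have "norm (ou_weight \<omega> * indicator {x<..} (ou_jump b \<omega>))
        \<le> norm (ou_weight \<omega> * gauss_weight (ou_jump b \<omega>) / gauss_weight x)" for \<omega>
    proof (cases "x < ou_jump b \<omega>")
      case True
      then have "gauss_weight x \<le> gauss_weight (ou_jump b \<omega>)"
        using x by (auto intro!: power_mono)
      moreover have "0 < gauss_weight x"
        using x by simp
      ultimately have "1 \<le> gauss_weight (ou_jump b \<omega>) / gauss_weight x"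
        by (simp only: le_divide_eq_1_pos)
      then have "\<bar>ou_weight \<omega>\<bar> * 1 \<le> \<bar>ou_weight \<omega>\<bar> * \<bar>gauss_weight (ou_jump b \<omega>) / gauss_weight x\<bar>"
        by (intro mult_left_mono) (rule order_trans[OF _ abs_ge_self], auto)
      then show ?thesis
        using True by (simp add: abs_mult)
    qed simp
    then show "AE \<omega> in jump_space. norm (ou_weight \<omega> * indicator {x<..} (ou_jump b \<omega>))
        \<le> norm (ou_weight \<omega> * gauss_weight (ou_jump b \<omega>) / gauss_weight x)"
      by (intro AE_I2)
  qed measurable
  have "(\<integral>\<omega>. ou_weight \<omega> * indicator {x<..} (ou_jump b \<omega>) \<partial>jump_space) =
      (\<integral>k. \<integral>t. ou_weight (k, t) * indicator {x<..} (ou_jump b (k, t)) \<partial>lborel \<partial>count_space UNIV)"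
    by (rule integral_fst'[OF int, symmetric])
  also have "\<dots> = infsetsum (\<lambda>k. if 1 \<le> k then 2 powi (- k) * T k else 0) UNIV"
    by (simp only: inner_int infsetsum_def)
  also have "\<dots> = infsetsum (\<lambda>k. 2 powi (- k) * T k) {1..}"
    by (rule infsetsum_cong_neutral) auto
  also have "\<dots> = infsetsum (\<lambda>n. 2 powi (- (int n + 1)) * T (int n + 1)) UNIV"
    by (rule infsetsum_reindex_bij_betw[symmetric]) (rule bij_betwI[where g="\<lambda>k. nat (k - 1)"], auto)
  also have "(\<lambda>n. 2 powi (- (int n + 1)) * T (int n + 1)) = (\<lambda>n. (1 / 2) ^ Suc n * (real (Suc n) * (ln 2 / b) - ln x / b))"
  proof
    fix n
    have e: "- (int n + 1) = - int (Suc n)"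
      by simp
    show "2 powi (- (int n + 1)) * T (int n + 1) = (1 / 2) ^ Suc n * (real (Suc n) * (ln 2 / b) - ln x / b)"
      unfolding T_def e power_int_minus power_int_of_nat
      by (simp add: power_one_over inverse_eq_divide diff_divide_distrib add.commute del: power_Suc)
  qed
  also have "infsetsum \<dots> UNIV = 2 * (ln 2 / b) - ln x / b"
  proof -
    \<comment> \<open>The terms are nonnegative, so convergence of the series is absolute.\<close>
    have "ln x / b \<le> real (Suc n) * (ln 2 / b)" for n
      using T_nonneg[of "int (Suc n)"] by (simp add: T_def diff_divide_distrib)
    then have "Infinite_Set_Sum.abs_summable_on
        (\<lambda>n. (1 / 2) ^ Suc n * (real (Suc n) * (ln 2 / b) - ln x / b)) UNIV"
      using sums_summable[OF sums_half_power_tail[of "ln 2 / b" "ln x / b"]]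
      by (simp add: abs_summable_on_nat_iff' abs_mult del: power_Suc of_nat_Suc)
    then show ?thesis
      using sums_half_power_tail[of "ln 2 / b" "ln x / b"]
      by (simp add: infsetsum_nat' sums_iff del: power_Suc of_nat_Suc)
  qed
  finally show "(\<integral>\<omega>. ou_weight \<omega> * indicator {x<..} (ou_jump b \<omega>) \<partial>jump_space) = (2 * ln 2 - ln x) / b"
    by (simp add: diff_divide_distrib)
qed

text \<open>Supplies the limit law of \<open>small_time_tail\<close>: \<open>Q\<close> is the Levy
  measure of U, multiplied by the weight and normalised by its mass \<open>c\<close>.\<close>

lemma ou_small_time_tail:
  fixes p :: "nat \<Rightarrow> real measure"
  assumes b: "0 < b" and x: "1 \<le> x" "x < 2"
    and p: "\<And>m. real_distribution (p m)"
    and r: "\<And>m. 0 < r m" "filterlim r at_top sequentially"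
    and char_p: "\<And>m z. char (p m) z = exp (ou_exponent b z / of_real (r m))"
  shows "(\<lambda>m. r m * measure (p m) {x<..}) \<longlonglongrightarrow> (2 * ln 2 - ln x) / b"
proof -
  define w where "w \<omega> = ou_weight \<omega> * gauss_weight (ou_jump b \<omega>)" for \<omega>
  define c where "c = (\<integral>\<omega>. w \<omega> \<partial>jump_space)"
  have w_nonneg: "0 \<le> w \<omega>" for \<omega>
    by (auto simp: w_def ou_weight_def split: prod.split intro!: mult_nonneg_nonneg)
  have w_int: "integrable jump_space w"
    unfolding w_def[abs_def] by (rule ou_exponent_gauss_difference[OF b])
  have [measurable]: "w \<in> borel_measurable jump_space"
    using w_int by auto
  have pos: "0 < (2 * ln 2 - ln x) / b"
  proof -
    have "ln x < 2 * ln 2"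
      using x ln_less_cancel_iff[of x 2] ln_gt_zero[of "2::real"] by linarith
    then show ?thesis
      using b by simp
  qed
  \<comment> \<open>The Levy measure charges \<open>{x<..}\<close>, where the weight is positive, so
    the weighted mass cannot vanish.\<close>
  have "c \<noteq> 0"
  proof
    assume "c = 0"
    then have "AE \<omega> in jump_space. w \<omega> = 0"
      using integral_nonneg_eq_0_iff_AE[OF w_int] w_nonneg by (simp add: c_def)
    then have "AE \<omega> in jump_space. ou_weight \<omega> * indicator {x<..} (ou_jump b \<omega>) = 0"
      using x by (auto simp: w_def elim!: eventually_mono split: split_indicator)
    then have "(\<integral>\<omega>. ou_weight \<omega> * indicator {x<..} (ou_jump b \<omega>) \<partial>jump_space) = (\<integral>\<omega>. 0 \<partial>jump_space)"
      by (intro integral_cong_AE) auto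
    then show False
      using pos by (auto simp: ou_levy_measure_tail[OF b x])
  qed
  moreover have "0 \<le> c"
    unfolding c_def by (intro Bochner_Integration.integral_nonneg w_nonneg)
  ultimately have c: "0 < c"
    by simp
  define D where "D = density jump_space (\<lambda>\<omega>. w \<omega> / c)"
  define Q where "Q = distr D borel (ou_jump b)"
  have sets_D [measurable_cong, simp]: "sets D = sets jump_space"
    by (simp add: D_def)
  have Q_int: "(\<integral>y. f y \<partial>Q) = (\<integral>\<omega>. (w \<omega> / c) *\<^sub>R f (ou_jump b \<omega>) \<partial>jump_space)"
    if [measurable]: "f \<in> borel_measurable borel" for f :: "real \<Rightarrow> 'b::{banach, second_countable_topology}"
  proof -
    have "(\<integral>y. f y \<partial>Q) = (\<integral>\<omega>. f (ou_jump b \<omega>) \<partial>D)"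
      unfolding Q_def by (rule integral_distr) auto
    also have "\<dots> = (\<integral>\<omega>. (w \<omega> / c) *\<^sub>R f (ou_jump b \<omega>) \<partial>jump_space)"
      unfolding D_def using w_nonneg c by (intro integral_density) auto
    finally show ?thesis .
  qed
  have "prob_space D"
  proof (rule prob_spaceI)
    have "emeasure D (space D) = (\<integral>\<^sup>+\<omega>. ennreal (w \<omega> / c) \<partial>jump_space)"
      unfolding D_def using sets.top[of jump_space] by (subst emeasure_density) (auto intro!: nn_integral_cong simp: space_pair_measure)
    also have "\<dots> = ennreal (\<integral>\<omega>. w \<omega> / c \<partial>jump_space)"
      using w_nonneg c by (intro nn_integral_eq_integral integrable_divide w_int) auto
    also have "\<dots> = 1"
      using c by (simp add: c_def)
    finally show "emeasure D (space D) = 1" .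
  qed
  then interpret D: prob_space D .
  have Q: "real_distribution Q"
    unfolding Q_def by (rule D.real_distribution_distr) measurable
  then interpret Q: real_distribution Q .
  have "(\<lambda>m. r m * measure (p m) {x<..}) \<longlonglongrightarrow> c * (\<integral>y. indicator {x<..} y / gauss_weight y \<partial>Q)"
  proof (rule small_time_tail[OF p r char_p _ norm_ou_exponent_le[OF b] Q c])
    show "ou_exponent b \<in> borel_measurable borel"
      by measurable
    show "of_real c * char Q z = ou_exponent b z - (CLINT s|std_normal_distribution. ou_exponent b (z + s))" for z
    proof -
      have "of_real c * char Q z = (CLINT \<omega>|jump_space. of_real (w \<omega>) * iexp (z * ou_jump b \<omega>) / of_real c) * of_real c"
        unfolding char_def by (subst Q_int) (auto simp: scaleR_conv_of_real mult.commute)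
      then show ?thesis
        using c unfolding ou_exponent_gauss_difference(2)[OF b] w_def[symmetric] by simp
    qed
    have "measure Q {x} = (\<integral>y. indicator {x} y \<partial>Q)"
      by simp
    also have "\<dots> = (\<integral>\<omega>. (w \<omega> / c) *\<^sub>R indicator {x} (ou_jump b \<omega>) \<partial>jump_space)"
      by (subst Q_int) auto
    also have "\<dots> = (\<integral>\<omega>. 0 \<partial>jump_space)"
      using AE_ou_jump_neq[OF b, of x] x by (intro integral_cong_AE) auto
    finally show "measure Q {x} = 0"
      by simp
  qed (use x in auto)
  also have "c * (\<integral>y. indicator {x<..} y / gauss_weight y \<partial>Q) =
      c * (\<integral>\<omega>. ou_weight \<omega> * indicator {x<..} (ou_jump b \<omega>) / c \<partial>jump_space)"
  proof -
    have "w \<omega> / c * (indicator {x<..} (ou_jump b \<omega>) / gauss_weight (ou_jump b \<omega>)) =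
        ou_weight \<omega> * indicator {x<..} (ou_jump b \<omega>) / c" for \<omega>
      using x by (auto simp: w_def split: split_indicator)
    then show ?thesis
      by (subst Q_int) auto
  qed
  also have "\<dots> = (2 * ln 2 - ln x) / b"
    using c by (simp add: ou_levy_measure_tail[OF b x])
  finally show ?thesis .
qed

section \<open>The characteristic function of the stochastic integral\<close>

lemma norm_iexp_diff_le: "norm (iexp u - iexp v) \<le> \<bar>u - v\<bar>"
proof -
  have "iexp u - iexp v = iexp v * (iexp (u - v) - 1)"
    by (simp add: algebra_simps flip: exp_add)
  then have "norm (iexp u - iexp v) = norm (iexp (u - v) - 1)"
    by (simp add: norm_mult)
  also have "\<dots> \<le> \<bar>u - v\<bar>"
    using iexp_approx1[of "u - v" 0] by simp
  finally show ?thesis .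
qed

text \<open>Where X and Y are within \<open>\<epsilon>\<close>, the wave is Lipschitz with constant
  \<open>\<bar>z\<bar>\<close>; elsewhere the trivial bound 2 is used.\<close>

lemma (in prob_space) norm_char_diff_le:
  assumes [measurable]: "X \<in> borel_measurable M" "Y \<in> borel_measurable M" and "0 \<le> \<epsilon>"
  shows "norm (char (distr M borel X) z - char (distr M borel Y) z) \<le>
    \<bar>z\<bar> * \<epsilon> + 2 * \<P>(\<omega> in M. \<bar>X \<omega> - Y \<omega>\<bar> > \<epsilon>)"
proof -
  let ?B = "{\<omega> \<in> space M. \<bar>X \<omega> - Y \<omega>\<bar> > \<epsilon>}"
  have int: "integrable M (\<lambda>\<omega>. iexp (z * X \<omega>))" if [measurable]: "X \<in> borel_measurable M" for X
    by (rule integrable_const_bound[where B=1]) auto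
  have "norm (char (distr M borel X) z - char (distr M borel Y) z) =
      norm (CLINT \<omega>|M. iexp (z * X \<omega>) - iexp (z * Y \<omega>))"
    unfolding char_def by (simp add: integral_distr int del: of_real_mult)
  also have "\<dots> \<le> (\<integral>\<omega>. norm (iexp (z * X \<omega>) - iexp (z * Y \<omega>)) \<partial>M)"
    by (rule integral_norm_bound)
  also have "\<dots> \<le> (\<integral>\<omega>. \<bar>z\<bar> * \<epsilon> + 2 * indicator ?B \<omega> \<partial>M)"
  proof (rule integral_mono)
    fix \<omega> assume \<omega>: "\<omega> \<in> space M"
    show "norm (iexp (z * X \<omega>) - iexp (z * Y \<omega>)) \<le> \<bar>z\<bar> * \<epsilon> + 2 * indicator ?B \<omega>"
    proof (cases "\<omega> \<in> ?B")
      case True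
      have "norm (iexp (z * X \<omega>) - iexp (z * Y \<omega>)) \<le> norm (iexp (z * X \<omega>)) + norm (iexp (z * Y \<omega>))"
        by (rule norm_triangle_ineq4)
      then show ?thesis
        using True \<open>0 \<le> \<epsilon>\<close> by (simp del: of_real_mult add: add_increasing)
    next
      case False
      have "norm (iexp (z * X \<omega>) - iexp (z * Y \<omega>)) \<le> \<bar>z * X \<omega> - z * Y \<omega>\<bar>"
        by (rule norm_iexp_diff_le)
      also have "\<dots> = \<bar>z\<bar> * \<bar>X \<omega> - Y \<omega>\<bar>"
        by (simp flip: abs_mult right_diff_distrib)
      also have "\<dots> \<le> \<bar>z\<bar> * \<epsilon>"
        using False \<omega> by (intro mult_left_mono) auto
      finally show ?thesis
        using False by simp
    qed
  qed (auto intro!: integrable_norm Bochner_Integration.integrable_diff int Bochner_Integration.integrable_add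
      integrable_mult_right simp: emeasure_eq_measure simp del: of_real_mult)
  also have "\<dots> = \<bar>z\<bar> * \<epsilon> + 2 * \<P>(\<omega> in M. \<bar>X \<omega> - Y \<omega>\<bar> > \<epsilon>)"
    by (subst Bochner_Integration.integral_add) (auto simp: emeasure_eq_measure prob_space)
  finally show ?thesis .
qed

lemma (in prob_space) tendsto_in_prob_char:
  assumes conv: "tendsto_in_prob M X Y F"
    and X: "eventually (\<lambda>i. X i \<in> borel_measurable M) F" and Y: "Y \<in> borel_measurable M"
  shows "((\<lambda>i. char (distr M borel (X i)) z) \<longlongrightarrow> char (distr M borel Y) z) F"
proof (rule tendstoI)
  fix e :: real assume "0 < e"
  \<comment> \<open>The two errors are below \<open>e / 2\<close> and \<open>2 * (e / 4)\<close>;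
    the \<open>+ 1\<close> covers \<open>z = 0\<close>.\<close>
  define \<epsilon> where "\<epsilon> = e / (2 * (\<bar>z\<bar> + 1))"
  have \<epsilon>: "0 < \<epsilon>" "\<bar>z\<bar> * \<epsilon> < e / 2"
    using \<open>0 < e\<close> by (auto simp: \<epsilon>_def field_simps)
  have "((\<lambda>i. \<P>(\<omega> in M. \<bar>X i \<omega> - Y \<omega>\<bar> > \<epsilon>)) \<longlongrightarrow> 0) F"
    using conv \<epsilon> by (auto simp: tendsto_in_prob_def)
  then have "eventually (\<lambda>i. \<P>(\<omega> in M. \<bar>X i \<omega> - Y \<omega>\<bar> > \<epsilon>) < e / 4) F"
    using \<open>0 < e\<close> by (intro order_tendstoD) auto
  then show "eventually (\<lambda>i. dist (char (distr M borel (X i)) z) (char (distr M borel Y) z) < e) F"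
    using X
  proof eventually_elim
    case (elim i)
    from elim(1) norm_char_diff_le[OF elim(2) Y, of \<epsilon> z] \<epsilon> show ?case
      by (simp add: dist_norm)
  qed
qed

lemma tendsto_in_prob_compose:
  "tendsto_in_prob M X Y F \<Longrightarrow> filterlim g F G \<Longrightarrow> tendsto_in_prob M (\<lambda>i. X (g i)) Y G"
  unfolding tendsto_in_prob_def by (auto intro: filterlim_compose)

text \<open>A limit along all fine subdivisions can be evaluated along this one sequence;
  \<open>Suc n\<close> avoids a subdivision into zero pieces.\<close>

lemma filterlim_uniform_partition:
  assumes "0 < T"
  shows "filterlim (\<lambda>n. (Suc n, \<lambda>i. real i * (T / real (Suc n)))) (fine_partitions T) sequentially"
  unfolding fine_partitions_def filterlim_INF filterlim_principal
proof
  fix \<delta> :: real assume "\<delta> \<in> {0<..}"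
  then have "eventually (\<lambda>n. T / real (Suc n) < \<delta>) sequentially"
    using LIMSEQ_Suc[OF lim_const_over_n[of T]] by (intro order_tendstoD) auto
  then show "eventually (\<lambda>n. (Suc n, \<lambda>i. real i * (T / real (Suc n))) \<in> {(n, \<tau>). \<tau> 0 = 0 \<and> \<tau> n = T \<and>
     (\<forall>i<n. \<tau> i < \<tau> (Suc i) \<and> \<tau> (Suc i) - \<tau> i < \<delta>)}) sequentially"
  proof eventually_elim
    case (elim n)
    have "real (Suc i) * (T / real (Suc n)) - real i * (T / real (Suc n)) = T / real (Suc n)" for i
      by (subst left_diff_distrib[symmetric]) simp
    moreover have "0 < T / real (Suc n)"
      using assms by simp
    ultimately show ?case
      using elim by (auto simp del: of_nat_Suc simp: diff_less_eq)
        (metis add.commute add_less_cancel_left diff_add_cancel add_0)+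
  qed
qed

lemma riemann_sum_tendsto_integral:
  fixes h :: "real \<Rightarrow> complex"
  assumes h: "continuous_on {0..T} h" and T: "0 < T"
  shows "(\<lambda>n. \<Sum>i<Suc n. of_real (T / real (Suc n)) * h (real i * (T / real (Suc n)))) \<longlonglongrightarrow> integral {0..T} h"
proof (rule LIMSEQ_I)
  fix r :: real assume "0 < r"
  \<comment> \<open>Each of the cells of length \<open>c\<close> contributes an error of at most
    \<open>e * c\<close>, in total \<open>e * T = r / 2\<close>.\<close>
  define e where "e = r / (2 * T)"
  have "0 < e"
    using \<open>0 < r\<close> T by (simp add: e_def)
  have "uniformly_continuous_on {0..T} h"
    by (intro compact_uniformly_continuous h) simp
  then obtain d where d: "0 < d" "\<And>s t. s \<in> {0..T} \<Longrightarrow> t \<in> {0..T} \<Longrightarrow> dist t s < d \<Longrightarrow> dist (h t) (h s) < e"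
    using \<open>0 < e\<close> unfolding uniformly_continuous_on_def by metis
  have "eventually (\<lambda>n. T / real (Suc n) < d) sequentially"
    using LIMSEQ_Suc[OF lim_const_over_n[of T]] d(1) by (intro order_tendstoD) auto
  then obtain N where N: "\<And>n. N \<le> n \<Longrightarrow> T / real (Suc n) < d"
    by (auto simp: eventually_sequentially)
  show "\<exists>N. \<forall>n\<ge>N. norm ((\<Sum>i<Suc n. of_real (T / real (Suc n)) * h (real i * (T / real (Suc n)))) - integral {0..T} h) < r"
  proof (intro exI allI impI)
    fix n assume "N \<le> n"
    define c where "c = T / real (Suc n)"
    have c: "0 < c" "c < d" "real (Suc n) * c = T"
      using T N[OF \<open>N \<le> n\<close>] by (auto simp: c_def)
    have le_T: "real k * c \<le> T" if "k \<le> Suc n" for k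
      unfolding c(3)[symmetric] using that c(1) by (intro mult_right_mono) auto
    have int_sum: "integral {0..real k * c} h = (\<Sum>i<k. integral {real i * c..real (Suc i) * c} h)" if "k \<le> Suc n" for k
      using that
    proof (induction k)
      case (Suc k)
      have "integral {0..real k * c} h + integral {real k * c..real (Suc k) * c} h = integral {0..real (Suc k) * c} h"
        using c(1) le_T[OF Suc.prems]
        by (intro Henstock_Kurzweil_Integration.integral_combine integrable_continuous_interval
            continuous_on_subset[OF h]) (auto intro: mult_right_mono)
      then show ?case
        using Suc by simp
    qed simp
    have piece: "norm (of_real c * h (real i * c) - integral {real i * c..real (Suc i) * c} h) \<le> e * c" if "i < Suc n" for i
    proof -
      have sub: "{real i * c..real (Suc i) * c} \<subseteq> {0..T}"
        using le_T[of "Suc i"] that c(1) by auto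
      have len: "real (Suc i) * c - real i * c = c" "real i * c \<le> real (Suc i) * c"
        using c(1) by (auto simp: algebra_simps)
      have cont: "continuous_on {real i * c..real (Suc i) * c} h"
        by (rule continuous_on_subset[OF h sub])
      have "integral {real i * c..real (Suc i) * c} (\<lambda>t. h (real i * c) - h t) =
          of_real c * h (real i * c) - integral {real i * c..real (Suc i) * c} h"
        using len integrable_continuous_interval[OF cont]
        by (subst Henstock_Kurzweil_Integration.integral_diff) (auto simp: scaleR_conv_of_real)
      moreover have "norm (integral {real i * c..real (Suc i) * c} (\<lambda>t. h (real i * c) - h t)) \<le>
          e * (real (Suc i) * c - real i * c)"
      proof (rule integral_bound)
        show "continuous_on {real i * c..real (Suc i) * c} (\<lambda>t. h (real i * c) - h t)"
          by (intro continuous_intros cont)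
        fix t assume t: "t \<in> {real i * c..real (Suc i) * c}"
        have "dist (real i * c) t < d"
          using t c(2) len by (auto simp: dist_real_def)
        moreover have "real i * c \<in> {0..T}" "t \<in> {0..T}"
          using subsetD[OF sub t] subsetD[OF sub, of "real i * c"] len(2) by simp_all
        ultimately have "dist (h (real i * c)) (h t) < e"
          by (intro d(2))
        then show "norm (h (real i * c) - h t) \<le> e"
          by (simp add: dist_norm)
      qed (rule len)
      ultimately show ?thesis
        unfolding len by simp
    qed
    have "norm ((\<Sum>i<Suc n. of_real c * h (real i * c)) - integral {0..T} h) =
        norm (\<Sum>i<Suc n. of_real c * h (real i * c) - integral {real i * c..real (Suc i) * c} h)"
      using int_sum[of "Suc n"] unfolding c(3) by (simp only: sum_subtractf order_refl)
    also have "\<dots> \<le> (\<Sum>i<Suc n. e * c)"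
      by (intro sum_norm_le piece) auto
    also have "\<dots> = e * T"
      by (simp add: c(3)[symmetric])
    also have "\<dots> < r"
      using \<open>0 < r\<close> T by (simp add: e_def)
    finally show "norm ((\<Sum>i<Suc n. of_real (T / real (Suc n)) * h (real i * (T / real (Suc n)))) - integral {0..T} h) < r"
      unfolding c_def .
  qed
qed

section \<open>Riemann sums of the process and integrals over finite horizons\<close>

lemma (in levy_process) char_increment:
  assumes char_S: "\<And>t z. 0 \<le> t \<Longrightarrow> char (distr M borel (S t)) z = exp (of_real t * \<Psi> z)"
    and st: "0 \<le> s" "s \<le> t"
  shows "char (distr M borel (\<lambda>\<omega>. S t \<omega> - S s \<omega>)) z = exp (of_real (t - s) * \<Psi> z)"
proof -
  have [measurable]: "S t \<in> borel_measurable M" if "0 \<le> t" for t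
    using that by (rule measurable_process)
  have "distr M borel (\<lambda>\<omega>. S t \<omega> - S s \<omega>) = distr M borel (\<lambda>\<omega>. S (t - s) \<omega> - S 0 \<omega>)"
    using stationary_increments[of s "t - s"] st by simp
  also have "\<dots> = distr M borel (S (t - s))"
    using start_zero st by (intro distr_cong_AE) (auto simp: measurable_process)
  finally show ?thesis
    using char_S[of "t - s" z] st by simp
qed

lemma char_distr_cmult:
  assumes "X \<in> borel_measurable M"
  shows "char (distr M borel (\<lambda>\<omega>. c * X \<omega>)) z = char (distr M borel X) (z * c)"
  using assms by (simp add: char_def integral_distr mult.assoc)

lemma (in levy_process) char_riemann_sum:
  assumes char_S: "\<And>t z. 0 \<le> t \<Longrightarrow> char (distr M borel (S t)) z = exp (of_real t * \<Psi> z)"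
    and \<tau>: "0 \<le> \<tau> 0" "\<And>i. i < n \<Longrightarrow> \<tau> i < \<tau> (Suc i)"
  shows "char (distr M borel (\<lambda>\<omega>. \<Sum>i<n. f (\<tau> i) * (S (\<tau> (Suc i)) \<omega> - S (\<tau> i) \<omega>))) z =
    exp (\<Sum>i<n. of_real (\<tau> (Suc i) - \<tau> i) * \<Psi> (z * f (\<tau> i)))"
proof -
  have \<tau>_nonneg: "0 \<le> \<tau> i" if "i \<le> n" for i
    using that
  proof (induction i)
    case (Suc i)
    then show ?case
      using \<tau>(2)[of i] by simp
  qed (simp add: \<tau>)
  have "indep_vars (\<lambda>_. borel) (\<lambda>i \<omega>. S (\<tau> (Suc i)) \<omega> - S (\<tau> i) \<omega>) {..<n}"
    using \<tau> by (intro indep_increments) auto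
  then have "indep_vars (\<lambda>_. borel) (\<lambda>i. (\<lambda>y. f (\<tau> i) * y) \<circ> (\<lambda>\<omega>. S (\<tau> (Suc i)) \<omega> - S (\<tau> i) \<omega>)) {..<n}"
    by (rule indep_vars_compose) auto
  then have "char (distr M borel (\<lambda>\<omega>. \<Sum>i<n. f (\<tau> i) * (S (\<tau> (Suc i)) \<omega> - S (\<tau> i) \<omega>))) z =
      (\<Prod>i<n. char (distr M borel (\<lambda>\<omega>. f (\<tau> i) * (S (\<tau> (Suc i)) \<omega> - S (\<tau> i) \<omega>))) z)"
    by (subst char_distr_sum[symmetric]) (auto simp: comp_def)
  also have "\<dots> = (\<Prod>i<n. exp (of_real (\<tau> (Suc i) - \<tau> i) * \<Psi> (z * f (\<tau> i))))"
  proof (rule prod.cong)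
    fix i assume i: "i \<in> {..<n}"
    then have [measurable]: "S (\<tau> i) \<in> borel_measurable M" "S (\<tau> (Suc i)) \<in> borel_measurable M"
      using \<tau>_nonneg by (auto intro: measurable_process)
    show "char (distr M borel (\<lambda>\<omega>. f (\<tau> i) * (S (\<tau> (Suc i)) \<omega> - S (\<tau> i) \<omega>))) z =
        exp (of_real (\<tau> (Suc i) - \<tau> i) * \<Psi> (z * f (\<tau> i)))"
      using i \<tau>_nonneg[of i] \<tau>(2)[of i]
      by (subst char_distr_cmult, measurable) (intro char_increment char_S, auto)
  qed simp
  also have "\<dots> = exp (\<Sum>i<n. of_real (\<tau> (Suc i) - \<tau> i) * \<Psi> (z * f (\<tau> i)))"
    by (simp add: exp_sum)
  finally show ?thesis .
qed

text \<open>Independence of the increments makes the exponent of a stochastic Riemann sum an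
  ordinary Riemann sum of \<open>\<Psi> (z * f t)\<close>; both converge along uniform
  subdivisions.\<close>

lemma (in levy_process) char_has_stoch_integral:
  assumes char_S: "\<And>t z. 0 \<le> t \<Longrightarrow> char (distr M borel (S t)) z = exp (of_real t * \<Psi> z)"
    and J: "has_stoch_integral M S f T J" and T: "0 < T"
    and cont: "continuous_on {0..T} (\<lambda>t. \<Psi> (z * f t))"
  shows "char (distr M borel J) z = exp (integral {0..T} (\<lambda>t. \<Psi> (z * f t)))"
proof -
  define \<tau> where "\<tau> n i = real i * (T / real (Suc n))" for n i
  define R where "R n \<omega> = (\<Sum>i<Suc n. f (\<tau> n i) * (S (\<tau> n (Suc i)) \<omega> - S (\<tau> n i) \<omega>))" for n \<omega>
  have \<tau>_diff: "\<tau> n (Suc i) - \<tau> n i = T / real (Suc n)" for n i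
    unfolding \<tau>_def by (subst left_diff_distrib[symmetric]) simp
  have \<tau>_nonneg: "0 \<le> \<tau> n i" for n i
    using T by (simp add: \<tau>_def)
  have [measurable]: "S (\<tau> n i) \<in> borel_measurable M" for n i
    by (intro measurable_process \<tau>_nonneg)
  have J_meas: "J \<in> borel_measurable M"
    using J by (simp add: has_stoch_integral_def)
  have "tendsto_in_prob M R J sequentially"
    using tendsto_in_prob_compose[OF _ filterlim_uniform_partition[OF T]] J
    unfolding has_stoch_integral_def R_def[abs_def] \<tau>_def[abs_def] by fastforce
  moreover have "R n \<in> borel_measurable M" for n
    unfolding R_def[abs_def] by measurable
  ultimately have "(\<lambda>n. char (distr M borel (R n)) z) \<longlonglongrightarrow> char (distr M borel J) z"
    by (intro tendsto_in_prob_char J_meas) auto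
  moreover have "char (distr M borel (R n)) z =
      exp (\<Sum>i<Suc n. of_real (T / real (Suc n)) * \<Psi> (z * f (\<tau> n i)))" for n
  proof -
    have "\<tau> n i < \<tau> n (Suc i)" for i
      using \<tau>_diff[of n i] T by (metis diff_gt_0_iff_gt divide_pos_pos of_nat_0_less_iff zero_less_Suc)
    then show ?thesis
      unfolding R_def[abs_def] using \<tau>_nonneg
      by (subst char_riemann_sum[OF char_S]) (auto simp: \<tau>_diff)
  qed
  moreover have "(\<lambda>n. exp (\<Sum>i<Suc n. of_real (T / real (Suc n)) * \<Psi> (z * f (\<tau> n i)))) \<longlonglongrightarrow>
      exp (integral {0..T} (\<lambda>t. \<Psi> (z * f t)))"
    unfolding \<tau>_def by (intro tendsto_exp riemann_sum_tendsto_integral[OF cont T])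
  ultimately show ?thesis
    using LIMSEQ_unique by simp blast
qed

section \<open>The infinite horizon and the doubling relation\<close>

lemma ou_exponent_eq_integral:
  assumes "0 < b"
  shows "integrable lborel (\<lambda>t. indicator {0<..} t *\<^sub>R levy_exponent (z * exp (- (b * t))))"
    and "ou_exponent b z = (\<integral>t. indicator {0<..} t *\<^sub>R levy_exponent (z * exp (- (b * t))) \<partial>lborel)"
proof -
  interpret pair_sigma_finite "count_space (UNIV :: int set)" "lborel :: real measure"
    by (rule pair_sigma_finite_jump_space)
  have int: "integrable jump_space (case_prod (\<lambda>k t. ou_integrand b z (k, t)))"
    using integrable_ou_integrand[OF assms] by simp
  have inner: "(\<integral>k. ou_integrand b z (k, t) \<partial>count_space UNIV) =
      indicator {0<..} t *\<^sub>R levy_exponent (z * exp (- (b * t)))" for t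
    by (simp add: ou_integrand_def levy_exponent_eq_infsetsum infsetsum_def)
  show "integrable lborel (\<lambda>t. indicator {0<..} t *\<^sub>R levy_exponent (z * exp (- (b * t))))"
    using integrable_snd[OF int] by (simp only: inner)
  show "ou_exponent b z = (\<integral>t. indicator {0<..} t *\<^sub>R levy_exponent (z * exp (- (b * t))) \<partial>lborel)"
    using integral_snd[OF int] by (simp add: inner ou_exponent_def)
qed

lemma integral_levy_exponent_tendsto:
  assumes b: "0 < b"
  shows "(\<lambda>n. integral {0..real (Suc n)} (\<lambda>t. levy_exponent (z * exp (- (b * t))))) \<longlonglongrightarrow> ou_exponent b z"
proof -
  let ?h = "\<lambda>t. levy_exponent (z * exp (- (b * t)))"
  have cont: "continuous_on A ?h" for A
    by (intro continuous_at_imp_continuous_on ballI isCont_o2[OF _ isCont_levy_exponent] continuous_intros)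
  have [measurable]: "?h \<in> borel_measurable borel"
    by (rule borel_measurable_continuous_onI[OF cont])
  have "(\<lambda>n. \<integral>t. indicator {0..real (Suc n)} t *\<^sub>R ?h t \<partial>lborel) \<longlonglongrightarrow>
      (\<integral>t. indicator {0<..} t *\<^sub>R ?h t \<partial>lborel)"
  proof (rule integral_dominated_convergence)
    show "integrable lborel (\<lambda>t. norm (indicator {0<..} t *\<^sub>R ?h t))"
      by (intro integrable_norm ou_exponent_eq_integral b)
    \<comment> \<open>The finite horizons include the endpoint 0 and \<open>{0<..}\<close> does not;
      pointwise convergence and domination hold off this null set.\<close>
    have 0: "AE t in lborel. t \<noteq> (0::real)"
      by (rule AE_lborel_singleton)
    show "AE t in lborel. (\<lambda>n. indicator {0..real (Suc n)} t *\<^sub>R ?h t) \<longlonglongrightarrow> indicator {0<..} t *\<^sub>R ?h t"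
      using 0
    proof eventually_elim
      case (elim t)
      obtain N where "t \<le> real N"
        using real_arch_simple by blast
      then have "indicator {0..real (Suc n)} t = (indicator {0<..} t :: real)" if "N \<le> n" for n
        using elim that by (auto split: split_indicator)
      then show ?case
        by (intro tendsto_eventually) (auto simp: eventually_sequentially intro!: exI[of _ N])
    qed
    show "AE t in lborel. norm (indicator {0..real (Suc n)} t *\<^sub>R ?h t) \<le> norm (indicator {0<..} t *\<^sub>R ?h t)" for n
      using 0 by eventually_elim (auto split: split_indicator)
  qed measurable
  moreover have "(\<integral>t. indicator {0..T} t *\<^sub>R ?h t \<partial>lborel) = integral {0..T} ?h" for T
    using set_borel_integral_eq_integral(2)[OF borel_integrable_atLeastAtMost'[OF cont[of "{0..T}"]]]
    by (simp add: set_lebesgue_integral_def)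
  ultimately show ?thesis
    by (simp add: ou_exponent_eq_integral[OF b])
qed

text \<open>The drift in \<open>levy_exponent_double\<close> is discounted by
  \<open>exp (- (b * t))\<close>; its time integral \<open>1 / b\<close> is read off from the total
  mass of the exponential law.\<close>

lemma ou_exponent_double:
  assumes b: "0 < b"
  shows "ou_exponent b (2 * z) = 2 * ou_exponent b z - 2 * \<i> * of_real (z / b)"
proof -
  let ?h = "\<lambda>z t. indicator {0<..} t *\<^sub>R levy_exponent (z * exp (- (b * t)))"
  let ?e = "\<lambda>t::real. indicator {0<..} t * exp (- (b * t))"
  interpret D: prob_space "density lborel (exponential_density b)"
    by (rule prob_space_exponential_density[OF b])
  have e: "(\<integral>t. ?e t \<partial>lborel) = 1 / b"
  proof -
    have "(\<integral>t. exponential_density b t \<partial>lborel) = (\<integral>t. 1 \<partial>density lborel (exponential_density b))"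
    proof (subst integral_density)
      show "AE t in lborel. 0 \<le> exponential_density b t"
        using b by (simp add: exponential_density_def)
    qed auto
    also have "\<dots> = 1"
      using D.prob_space by simp
    also have "(\<integral>t. exponential_density b t \<partial>lborel) = (\<integral>t. b * ?e t \<partial>lborel)"
    proof (rule integral_cong_AE)
      show "AE t in lborel. exponential_density b t = b * ?e t"
        using AE_lborel_singleton[of "0::real"]
        by eventually_elim (auto simp: exponential_density_def mult.commute split: split_indicator)
    qed measurable
    finally show ?thesis
      using b by (simp add: field_simps)
  qed
  have "?h (2 * z) t = 2 * ?h z t - 2 * \<i> * of_real z * of_real (?e t)" for t
    using levy_exponent_double[of "z * exp (- (b * t))"]
    by (auto simp: mult.assoc split: split_indicator)
  then have "ou_exponent b (2 * z) = (\<integral>t. 2 * ?h z t - 2 * \<i> * of_real z * of_real (?e t) \<partial>lborel)"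
    by (simp add: ou_exponent_eq_integral[OF b])
  also have "\<dots> = 2 * ou_exponent b z - 2 * \<i> * of_real z * of_real (\<integral>t. ?e t \<partial>lborel)"
    unfolding ou_exponent_eq_integral(2)[OF b] integral_complex_of_real[symmetric]
    using ou_exponent_eq_integral(1)[OF b, of z] integrable_exp_decay[OF b]
    by (subst Bochner_Integration.integral_diff) (auto simp del: of_real_mult mult_scaleR_right)
  finally show ?thesis
    by (simp add: e)
qed

text \<open>Each of the m doublings contributes the same drift \<open>z / b\<close>, since the outer
  factor 2 offsets the halved argument. This linear growth is the origin of the centring
  \<open>m / (2 * a)\<close>.\<close>

lemma ou_exponent_power:
  assumes b: "0 < b"
  shows "ou_exponent b z = 2 ^ m * ou_exponent b (z / 2 ^ m) - \<i> * of_real (real m * z / b)"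
proof (induction m)
  case (Suc m)
  have "ou_exponent b (z / 2 ^ m) = 2 * ou_exponent b (z / 2 ^ Suc m) - 2 * \<i> * of_real (z / 2 ^ Suc m / b)"
    using ou_exponent_double[OF b, of "z / 2 ^ Suc m"] by simp
  with Suc show ?case
    by (simp add: algebra_simps add_divide_distrib)
qed simp

theorem theorem3p1:
  fixes M :: "'a measure" and S :: "real \<Rightarrow> 'a \<Rightarrow> real" and U :: "'a \<Rightarrow> real" and a x :: real
  assumes "1 \<le> a" and "a < 2"
    and "levy_process M S"
    and "\<And>t z. 0 \<le> t \<Longrightarrow> char (distr M borel (S t)) z = exp (of_real t * levy_exponent z)"
    and "has_stoch_integral_infinity M S (\<lambda>t. exp (- 2 * a * t)) U"
    and "1 \<le> x" and "x < 2"
  shows "(\<lambda>m::nat. 2 ^ m * \<P>(\<omega> in M. U \<omega> > x * 2 ^ m + real m / (2 * a)))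
           \<longlonglongrightarrow> (2 * ln 2 - ln x) / (2 * a)"
proof -
  interpret levy_process M S by fact
  define b where "b = 2 * a"
  have b: "0 < b"
    using \<open>1 \<le> a\<close> by (simp add: b_def)
  have f: "exp (- 2 * a * t) = exp (- (b * t))" for t
    by (simp add: b_def)
  obtain J where J: "\<And>T. 0 \<le> T \<Longrightarrow> has_stoch_integral M S (\<lambda>t. exp (- (b * t))) T (J T)"
    and JU: "tendsto_in_prob M J U at_top" and [measurable]: "U \<in> borel_measurable M"
    using assms(5) unfolding has_stoch_integral_infinity_def f by auto
  \<comment> \<open>The horizons \<open>Suc n\<close> are positive, as the formula for finite
    horizons requires.\<close>
  have char_U: "char (distr M borel U) z = exp (ou_exponent b z)" for z
  proof (rule LIMSEQ_unique)
    have "filterlim (\<lambda>n. real (Suc n)) at_top sequentially"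
      by (rule filterlim_compose[OF filterlim_real_sequentially filterlim_Suc])
    moreover have "J (real (Suc n)) \<in> borel_measurable M" for n
      using J[of "real (Suc n)"] by (simp add: has_stoch_integral_def)
    ultimately show "(\<lambda>n. char (distr M borel (J (real (Suc n)))) z) \<longlonglongrightarrow> char (distr M borel U) z"
      by (intro tendsto_in_prob_char tendsto_in_prob_compose[OF JU]) auto
    have "char (distr M borel (J (real (Suc n)))) z =
        exp (integral {0..real (Suc n)} (\<lambda>t. levy_exponent (z * exp (- (b * t)))))" for n
      by (intro char_has_stoch_integral assms J continuous_at_imp_continuous_on ballI
          isCont_o2[OF _ isCont_levy_exponent] continuous_intros) auto
    then show "(\<lambda>n. char (distr M borel (J (real (Suc n)))) z) \<longlonglongrightarrow> exp (ou_exponent b z)"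
      by (simp only:) (intro tendsto_exp integral_levy_exponent_tendsto b)
  qed
  define W where "W m \<omega> = (U \<omega> - real m / b) / 2 ^ m" for m \<omega>
  have W_meas [measurable]: "W m \<in> borel_measurable M" for m
    unfolding W_def[abs_def] by measurable
  \<comment> \<open>The centring produces the phase that cancels the accumulated drift; the division
    by \<open>2 ^ m\<close> in the exponent plays the part of \<open>r m\<close>.\<close>
  have char_W: "char (distr M borel (W m)) z = exp (ou_exponent b z / of_real (2 ^ m))" for m z
  proof -
    have "iexp (z * W m \<omega>) = iexp (- (real m * z / b) / 2 ^ m) * iexp (z / 2 ^ m * U \<omega>)" for \<omega>
      unfolding W_def by (simp add: diff_divide_distrib algebra_simps flip: exp_add)
    then have "char (distr M borel (W m)) z = (CLINT \<omega>|M. iexp (- (real m * z / b) / 2 ^ m) * iexp (z / 2 ^ m * U \<omega>))"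
      unfolding char_def by (simp add: integral_distr del: of_real_mult)
    also have "\<dots> = iexp (- (real m * z / b) / 2 ^ m) * char (distr M borel U) (z / 2 ^ m)"
      unfolding char_def by (simp add: integral_distr del: of_real_mult)
    also have "\<dots> = exp (ou_exponent b z / of_real (2 ^ m))"
      unfolding char_U exp_add[symmetric] ou_exponent_power[OF b, of z m] by (simp add: diff_divide_distrib)
    finally show ?thesis .
  qed
  have "(\<lambda>m. 2 ^ m * measure (distr M borel (W m)) {x<..}) \<longlonglongrightarrow> (2 * ln 2 - ln x) / b"
  proof (rule ou_small_time_tail[OF b])
    show "filterlim (\<lambda>m. 2 ^ m :: real) at_top sequentially"
      by (intro filterlim_at_infinity_imp_filterlim_at_top filterlim_realpow_sequentially_gt1) auto
  qed (use assms char_W in auto)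
  moreover have "measure (distr M borel (W m)) {x<..} = \<P>(\<omega> in M. U \<omega> > x * 2 ^ m + real m / (2 * a))" for m
  proof -
    have "x < W m \<omega> \<longleftrightarrow> x * 2 ^ m + real m / (2 * a) < U \<omega>" for \<omega>
      by (simp add: W_def b_def pos_less_divide_eq less_diff_eq)
    then show ?thesis
      by (subst measure_distr) (auto intro!: arg_cong[where f="measure M"])
  qed
  ultimately show ?thesis
    by (simp add: b_def)
qed

end
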